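(* Let $G$ be a finitely generated virtually abelian group, let $n$ be a positive integer, and let $V\subseteq G^n$ be an algebraic set of $G$. Then for every finite generating set $S$ of $G$ and every weight function $\|\cdot\|\colon S\to\mathbb{Z}_{>0}$, the weighted growth series $\mathbb{S}_{V\subseteq G^n,S}(z)$ is a rational function of $z$.
   Context: Algebraic set: a finite system of equations in $G$ with $n$ variables is a finite subset $\{w_1,\ldots,w_m\}$ of $G*F_n$, with $F_n$ free on $X_1,\ldots,X_n$; its solution set is the set of $(x_1,\ldots,x_n)\in G^n$ such that the homomorphism $G*F_n\to G$ that is the identity on $G$ and sends $X_i\mapsto x_i$ maps every $w_j$ to $1_G$. An algebraic set of $G$ is the solution set in $G^n$ of a finite system of equations in $n$ variables. Growth: $S$ generates $G$ in the sense that every element is represented by a word in $S^*$. Extend the weight to words by $\|s_1\cdots s_l\|=\sum_i\|s_i\|$, put $\|g\|=\min\{\|w\|\mid w\in S^*,\ w=_Gg\}$ for $g\in G$, and $\|\mathbf{x}\|=\sum_{i=1}^n\|x_i\|$ for $\mathbf{x}=(x_1,\ldots,x_n)\in G^n$. For $V\subseteq G^n$ let $\sigma_{V\subseteq G^n,S}(m)=\#\{\mathbf{x}\in V\mid\|\mathbf{x}\|=m\}$; the weighted growth series is $\mathbb{S}_{V\subseteq G^n,S}(z)=\sum_{m=0}^\infty\sigma_{V\subseteq G^n,S}(m)z^m\in\mathbb{Q}[[z]]$. Rational means lying in $\mathbb{Q}(z)$. *)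

theory Defs
  imports
    "HOL-Algebra.Generated_Groups"
    "HOL-Computational_Algebra.Polynomial_FPS"
    "HOL-Computational_Algebra.Formal_Laurent_Series"
begin

definition finitely_generated_group :: "('a, 'b) monoid_scheme \<Rightarrow> bool" where
  "finitely_generated_group G \<longleftrightarrow>
     group G \<and> (\<exists>A \<subseteq> carrier G. finite A \<and> generate G A = carrier G)"

definition virtually_abelian_group :: "('a, 'b) monoid_scheme \<Rightarrow> bool" where
  "virtually_abelian_group G \<longleftrightarrow>
     group G \<and> (\<exists>H. subgroup H G \<and> comm_group (G\<lparr>carrier := H\<rparr>) \<and> finite (rcosets\<^bsub>G\<^esub> H))"


text \<open>The free product of \<open>G\<close> with the free group on \<open>X\<^sub>1, \<dots>, X\<^sub>n\<close> is constructed as the set of words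
  in the elements of \<open>G\<close> and the letters \<open>X\<^sub>i\<close>, \<open>X\<^sub>i\<inverse>\<close>, modulo the congruence generated by the
  multiplication table of \<open>G\<close> and the free cancellations. The facts \<open>group_free_prod\<close> and
  \<open>free_prod_universal\<close> below show that this is a group with the universal property of the free
  product.\<close>

datatype 'a letter = Coef 'a | Var nat | VarInv nat

definition fp_words :: "('a, 'b) monoid_scheme \<Rightarrow> nat \<Rightarrow> 'a letter list set" where
  "fp_words G n = lists (Coef ` carrier G \<union> Var ` {1..n} \<union> VarInv ` {1..n})"

inductive_set fp_cong :: "('a, 'b) monoid_scheme \<Rightarrow> nat \<Rightarrow> ('a letter list \<times> 'a letter list) set"
  for G and n where
  refl: "w \<in> fp_words G n \<Longrightarrow> (w, w) \<in> fp_cong G n"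
| sym: "(v, w) \<in> fp_cong G n \<Longrightarrow> (w, v) \<in> fp_cong G n"
| trans: "(u, v) \<in> fp_cong G n \<Longrightarrow> (v, w) \<in> fp_cong G n \<Longrightarrow> (u, w) \<in> fp_cong G n"
| append: "(u, u') \<in> fp_cong G n \<Longrightarrow> (v, v') \<in> fp_cong G n \<Longrightarrow> (u @ v, u' @ v') \<in> fp_cong G n"
| one: "([Coef \<one>\<^bsub>G\<^esub>], []) \<in> fp_cong G n"
| mult: "g \<in> carrier G \<Longrightarrow> h \<in> carrier G \<Longrightarrow> ([Coef g, Coef h], [Coef (g \<otimes>\<^bsub>G\<^esub> h)]) \<in> fp_cong G n"
| r_cancel: "i \<in> {1..n} \<Longrightarrow> ([Var i, VarInv i], []) \<in> fp_cong G n"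
| l_cancel: "i \<in> {1..n} \<Longrightarrow> ([VarInv i, Var i], []) \<in> fp_cong G n"

definition fp_class :: "('a, 'b) monoid_scheme \<Rightarrow> nat \<Rightarrow> 'a letter list \<Rightarrow> 'a letter list set" where
  "fp_class G n w = fp_cong G n `` {w}"

definition free_prod :: "('a, 'b) monoid_scheme \<Rightarrow> nat \<Rightarrow> 'a letter list set monoid" where
  "free_prod G n =
     \<lparr>carrier = fp_words G n // fp_cong G n,
      monoid.mult = (\<lambda>A B. \<Union>a\<in>A. \<Union>b\<in>B. fp_class G n (a @ b)),
      monoid.one = fp_class G n []\<rparr>"

definition fp_coef :: "('a, 'b) monoid_scheme \<Rightarrow> nat \<Rightarrow> 'a \<Rightarrow> 'a letter list set" where
  "fp_coef G n g = fp_class G n [Coef g]"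

definition fp_var :: "('a, 'b) monoid_scheme \<Rightarrow> nat \<Rightarrow> nat \<Rightarrow> 'a letter list set" where
  "fp_var G n i = fp_class G n [Var i]"

text \<open>The homomorphism that is the identity on \<open>G\<close> and sends \<open>X\<^sub>i\<close> to \<open>x i\<close>; it exists and is unique by
  \<open>subst_hom_ex1\<close>. Extensionality only fixes the value \<open>undefined\<close> outside the carrier.\<close>

definition subst_hom ::
  "('a, 'b) monoid_scheme \<Rightarrow> nat \<Rightarrow> (nat \<Rightarrow> 'a) \<Rightarrow> 'a letter list set \<Rightarrow> 'a" where
  "subst_hom G n x =
     (THE \<phi>. \<phi> \<in> hom (free_prod G n) G \<and> \<phi> \<in> extensional (carrier (free_prod G n)) \<and>
        (\<forall>g\<in>carrier G. \<phi> (fp_coef G n g) = g) \<and> (\<forall>i\<in>{1..n}. \<phi> (fp_var G n i) = x i))"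

text \<open>The power \<open>G\<^sup>n\<close> is the set of extensional functions \<open>{1..n} \<rightarrow>\<^sub>E carrier G\<close>.\<close>

definition solution_set ::
  "('a, 'b) monoid_scheme \<Rightarrow> nat \<Rightarrow> 'a letter list set set \<Rightarrow> (nat \<Rightarrow> 'a) set" where
  "solution_set G n W =
     {x \<in> {1..n} \<rightarrow>\<^sub>E carrier G. \<forall>w\<in>W. subst_hom G n x w = \<one>\<^bsub>G\<^esub>}"

definition algebraic_set :: "('a, 'b) monoid_scheme \<Rightarrow> nat \<Rightarrow> (nat \<Rightarrow> 'a) set \<Rightarrow> bool" where
  "algebraic_set G n V \<longleftrightarrow>
     (\<exists>W. finite W \<and> W \<subseteq> carrier (free_prod G n) \<and> V = solution_set G n W)"


definition word_value :: "('a, 'b) monoid_scheme \<Rightarrow> 'a list \<Rightarrow> 'a" where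
  "word_value G w = foldr (\<lambda>s g. s \<otimes>\<^bsub>G\<^esub> g) w \<one>\<^bsub>G\<^esub>"

text \<open>Generation is by words in \<open>S\<close> itself: inverses of elements of \<open>S\<close> are not adjoined.\<close>

definition word_generates :: "('a, 'b) monoid_scheme \<Rightarrow> 'a set \<Rightarrow> bool" where
  "word_generates G S \<longleftrightarrow> S \<subseteq> carrier G \<and> (\<forall>g\<in>carrier G. \<exists>w\<in>lists S. word_value G w = g)"

definition word_weight :: "('a \<Rightarrow> nat) \<Rightarrow> 'a list \<Rightarrow> nat" where
  "word_weight \<omega> w = (\<Sum>s\<leftarrow>w. \<omega> s)"

definition elem_weight :: "('a, 'b) monoid_scheme \<Rightarrow> 'a set \<Rightarrow> ('a \<Rightarrow> nat) \<Rightarrow> 'a \<Rightarrow> nat" where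
  "elem_weight G S \<omega> g = (LEAST k. \<exists>w\<in>lists S. word_value G w = g \<and> word_weight \<omega> w = k)"

definition tuple_weight ::
  "('a, 'b) monoid_scheme \<Rightarrow> nat \<Rightarrow> 'a set \<Rightarrow> ('a \<Rightarrow> nat) \<Rightarrow> (nat \<Rightarrow> 'a) \<Rightarrow> nat" where
  "tuple_weight G n S \<omega> x = (\<Sum>i=1..n. elem_weight G S \<omega> (x i))"

definition growth_fun ::
  "('a, 'b) monoid_scheme \<Rightarrow> nat \<Rightarrow> 'a set \<Rightarrow> ('a \<Rightarrow> nat) \<Rightarrow> (nat \<Rightarrow> 'a) set \<Rightarrow> nat \<Rightarrow> nat" where
  "growth_fun G n S \<omega> V m = card {x \<in> V. tuple_weight G n S \<omega> x = m}"

definition growth_series ::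
  "('a, 'b) monoid_scheme \<Rightarrow> nat \<Rightarrow> 'a set \<Rightarrow> ('a \<Rightarrow> nat) \<Rightarrow> (nat \<Rightarrow> 'a) set \<Rightarrow> rat fps" where
  "growth_series G n S \<omega> V = Abs_fps (\<lambda>m. of_nat (growth_fun G n S \<omega> V m))"

text \<open>Membership in the field of rational functions is tested in the field of formal Laurent series,
  since the division of \<open>fps\<close> truncates; see \<open>rational_fps_iff\<close> for the form without division.\<close>

definition rational_fps :: "'k::field fps \<Rightarrow> bool" where
  "rational_fps F \<longleftrightarrow>
     (\<exists>p q. q \<noteq> 0 \<and> fps_to_fls F = fps_to_fls (fps_of_poly p) / fps_to_fls (fps_of_poly q))"

lemma rational_fps_iff:
  "rational_fps F \<longleftrightarrow> (\<exists>p q. q \<noteq> 0 \<and> F * fps_of_poly q = fps_of_poly p)"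
proof -
  have "fps_to_fls F = fps_to_fls (fps_of_poly p) / fps_to_fls (fps_of_poly q) \<longleftrightarrow>
        F * fps_of_poly q = fps_of_poly p" if "q \<noteq> 0" for p q :: "'a poly"
  proof -
    have "fps_to_fls (fps_of_poly q) \<noteq> 0"
      using that by simp
    then have "fps_to_fls F = fps_to_fls (fps_of_poly p) / fps_to_fls (fps_of_poly q) \<longleftrightarrow>
        fps_to_fls F * fps_to_fls (fps_of_poly q) = fps_to_fls (fps_of_poly p)"
      by (simp add: eq_divide_eq)
    also have "\<dots> \<longleftrightarrow> F * fps_of_poly q = fps_of_poly p"
      by (metis fls_times_fps_to_fls fps_to_fls_eq_iff)
    finally show ?thesis .
  qed
  then show ?thesis
    unfolding rational_fps_def by blast
qed


lemma fp_words_simps [simp]: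
  "[] \<in> fp_words G n"
  "Coef g # w \<in> fp_words G n \<longleftrightarrow> g \<in> carrier G \<and> w \<in> fp_words G n"
  "Var i # w \<in> fp_words G n \<longleftrightarrow> i \<in> {1..n} \<and> w \<in> fp_words G n"
  "VarInv i # w \<in> fp_words G n \<longleftrightarrow> i \<in> {1..n} \<and> w \<in> fp_words G n"
  "v @ w \<in> fp_words G n \<longleftrightarrow> v \<in> fp_words G n \<and> w \<in> fp_words G n"
  by (auto simp: fp_words_def)

context group
begin

lemma fp_cong_words:
  "(v, w) \<in> fp_cong G n \<Longrightarrow> v \<in> fp_words G n \<and> w \<in> fp_words G n"
  by (induction rule: fp_cong.induct) auto

lemma equiv_fp_cong: "equiv (fp_words G n) (fp_cong G n)"
  by (rule equivI) (auto simp: refl_on_def sym_def trans_def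
      dest: fp_cong_words intro: fp_cong.refl fp_cong.sym fp_cong.trans)

lemma fp_class_eq_iff:
  "v \<in> fp_words G n \<Longrightarrow> w \<in> fp_words G n \<Longrightarrow>
    fp_class G n v = fp_class G n w \<longleftrightarrow> (v, w) \<in> fp_cong G n"
  unfolding fp_class_def by (rule eq_equiv_class_iff[OF equiv_fp_cong])

lemma carrier_free_prod: "carrier (free_prod G n) = fp_class G n ` fp_words G n"
  by (auto simp: free_prod_def fp_class_def quotient_def)

lemma mult_free_prod:
  assumes "v \<in> fp_words G n" "w \<in> fp_words G n"
  shows "fp_class G n v \<otimes>\<^bsub>free_prod G n\<^esub> fp_class G n w = fp_class G n (v @ w)"
proof -
  have eq: "fp_class G n (a @ b) = fp_class G n (v @ w)"
    if "a \<in> fp_class G n v" "b \<in> fp_class G n w" for a b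
  proof -
    have "(v @ w, a @ b) \<in> fp_cong G n"
      using that by (auto simp: fp_class_def intro: fp_cong.append)
    then show ?thesis
      using fp_class_eq_iff fp_cong_words by metis
  qed
  have ne: "v \<in> fp_class G n v" "w \<in> fp_class G n w"
    using assms by (auto simp: fp_class_def intro: fp_cong.refl)
  have "fp_class G n v \<otimes>\<^bsub>free_prod G n\<^esub> fp_class G n w =
        (\<Union>a\<in>fp_class G n v. \<Union>b\<in>fp_class G n w. fp_class G n (a @ b))"
    by (simp add: free_prod_def)
  also have "\<dots> = (\<Union>a\<in>fp_class G n v. \<Union>b\<in>fp_class G n w. fp_class G n (v @ w))"
    by (intro SUP_cong HOL.refl eq)
  also have "\<dots> = fp_class G n (v @ w)"
    using ne by blast
  finally show ?thesis .
qed

lemma one_free_prod: "\<one>\<^bsub>free_prod G n\<^esub> = fp_class G n []"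
  by (simp add: free_prod_def)

lemma fp_left_inverse:
  assumes "w \<in> fp_words G n"
  shows "\<exists>v\<in>fp_words G n. (v @ w, []) \<in> fp_cong G n"
  using assms
proof (induction w)
  case Nil
  have "([] @ [], []) \<in> fp_cong G n"
    by (auto intro: fp_cong.refl)
  then show ?case
    by (intro bexI[of _ "[]"]) auto
next
  case (Cons l w)
  have w: "w \<in> fp_words G n"
    using Cons.prems by (cases l) auto
  then obtain v where v: "v \<in> fp_words G n" "(v @ w, []) \<in> fp_cong G n"
    using Cons.IH by blast
  obtain l' where l': "[l'] \<in> fp_words G n" "([l', l], []) \<in> fp_cong G n"
  proof (cases l)
    case (Coef g)
    then have "([Coef (inv g), Coef g], [Coef \<one>]) \<in> fp_cong G n"
      using fp_cong.mult[of "inv g" G g n] Cons.prems by auto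
    then show ?thesis
      using that[of "Coef (inv g)"] Coef Cons.prems fp_cong.one fp_cong.trans by fastforce
  next
    case (Var i)
    then show ?thesis
      using that[of "VarInv i"] Cons.prems fp_cong.l_cancel[of i n G] by simp
  next
    case (VarInv i)
    then show ?thesis
      using that[of "Var i"] Cons.prems fp_cong.r_cancel[of i n G] by simp
  qed
  have "(v @ ([l', l] @ w), v @ ([] @ w)) \<in> fp_cong G n"
    using v(1) w l'(2) by (intro fp_cong.append) (auto intro: fp_cong.refl)
  then have "((v @ [l']) @ l # w, []) \<in> fp_cong G n"
    using v(2) fp_cong.trans by fastforce
  moreover have "v @ [l'] \<in> fp_words G n"
    using v(1) l'(1) by simp
  ultimately show ?case
    by blast
qed

lemma group_free_prod: "group (free_prod G n)"
proof (rule groupI)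
  fix x assume "x \<in> carrier (free_prod G n)"
  then obtain w where w: "w \<in> fp_words G n" "x = fp_class G n w"
    by (auto simp: carrier_free_prod)
  then obtain v where "v \<in> fp_words G n" "(v @ w, []) \<in> fp_cong G n"
    using fp_left_inverse by blast
  then show "\<exists>y\<in>carrier (free_prod G n). y \<otimes>\<^bsub>free_prod G n\<^esub> x = \<one>\<^bsub>free_prod G n\<^esub>"
    using w by (auto simp: carrier_free_prod mult_free_prod one_free_prod fp_class_eq_iff)
qed (auto simp: carrier_free_prod mult_free_prod one_free_prod)

lemma fp_coef_hom: "fp_coef G n \<in> hom G (free_prod G n)"
  by (rule homI)
     (auto simp: fp_coef_def carrier_free_prod mult_free_prod fp_class_eq_iff
        intro: fp_cong.sym fp_cong.mult)

lemma fp_var_closed: "i \<in> {1..n} \<Longrightarrow> fp_var G n i \<in> carrier (free_prod G n)"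
  by (auto simp: fp_var_def carrier_free_prod)

end

fun letter_value :: "('c, 'd) monoid_scheme \<Rightarrow> ('a \<Rightarrow> 'c) \<Rightarrow> (nat \<Rightarrow> 'c) \<Rightarrow> 'a letter \<Rightarrow> 'c" where
  "letter_value H f x (Coef g) = f g"
| "letter_value H f x (Var i) = x i"
| "letter_value H f x (VarInv i) = inv\<^bsub>H\<^esub> x i"

definition eval_word :: "('c, 'd) monoid_scheme \<Rightarrow> ('a \<Rightarrow> 'c) \<Rightarrow> (nat \<Rightarrow> 'c) \<Rightarrow> 'a letter list \<Rightarrow> 'c" where
  "eval_word H f x w = word_value H (map (letter_value H f x) w)"

context
  fixes G :: "('a, 'b) monoid_scheme" and H :: "('c, 'd) monoid_scheme"
    and n :: nat and f :: "'a \<Rightarrow> 'c" and x :: "nat \<Rightarrow> 'c"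
  assumes G: "group G" and H: "group H" and f: "f \<in> hom G H" and x: "x \<in> {1..n} \<rightarrow> carrier H"
begin

interpretation G: group G by (rule G)
interpretation H: group H by (rule H)
interpretation F: group "free_prod G n" by (rule G.group_free_prod)

lemma eval_word_Nil: "eval_word H f x [] = \<one>\<^bsub>H\<^esub>"
  by (simp add: eval_word_def word_value_def)

lemma eval_word_Cons: "eval_word H f x (l # w) = letter_value H f x l \<otimes>\<^bsub>H\<^esub> eval_word H f x w"
  by (simp add: eval_word_def word_value_def)

lemma letter_value_closed: "[l] \<in> fp_words G n \<Longrightarrow> letter_value H f x l \<in> carrier H"
  using f x by (cases l) (auto simp: hom_def Pi_iff)

lemma fp_words_Cons: "l # w \<in> fp_words G n \<longleftrightarrow> [l] \<in> fp_words G n \<and> w \<in> fp_words G n"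
  by (simp add: fp_words_def)

lemma eval_word_closed: "w \<in> fp_words G n \<Longrightarrow> eval_word H f x w \<in> carrier H"
proof (induction w)
  case (Cons l w)
  then show ?case
    using letter_value_closed[of l] by (simp add: eval_word_Cons fp_words_Cons[of l w])
qed (simp add: eval_word_Nil)

lemma eval_word_append:
  "v \<in> fp_words G n \<Longrightarrow> w \<in> fp_words G n \<Longrightarrow>
    eval_word H f x (v @ w) = eval_word H f x v \<otimes>\<^bsub>H\<^esub> eval_word H f x w"
proof (induction v)
  case (Cons l v)
  then show ?case
    using letter_value_closed[of l] fp_words_Cons[of l v] eval_word_closed
    by (simp add: eval_word_Cons H.m_assoc)
qed (simp add: eval_word_Nil eval_word_closed)

lemma eval_word_cong: "(v, w) \<in> fp_cong G n \<Longrightarrow> eval_word H f x v = eval_word H f x w"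
proof (induction rule: fp_cong.induct)
  case (append u u' v v')
  then show ?case
    using G.fp_cong_words by (metis eval_word_append)
next
  case one
  then show ?case
    using hom_one[OF f G H] by (simp add: eval_word_Cons eval_word_Nil)
next
  case (mult g h)
  then show ?case
    using f by (simp add: eval_word_Cons eval_word_Nil hom_mult hom_in_carrier)
next
  case (r_cancel i)
  then show ?case
    using x by (auto simp: eval_word_Cons eval_word_Nil Pi_iff)
next
  case (l_cancel i)
  then show ?case
    using x by (auto simp: eval_word_Cons eval_word_Nil Pi_iff)
qed simp_all

lemma hom_free_prod_eq_eval_word:
  assumes \<phi>: "\<phi> \<in> hom (free_prod G n) H" "\<forall>g\<in>carrier G. \<phi> (fp_coef G n g) = f g"
    "\<forall>i\<in>{1..n}. \<phi> (fp_var G n i) = x i" and w: "w \<in> fp_words G n"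
  shows "\<phi> (fp_class G n w) = eval_word H f x w"
  using w
proof (induction w)
  case Nil
  have "\<phi> \<one>\<^bsub>free_prod G n\<^esub> = \<one>\<^bsub>H\<^esub>"
    using hom_one[OF \<phi>(1) F.is_group H] .
  then show ?case
    by (simp add: eval_word_Nil G.one_free_prod)
next
  case (Cons l w)
  then have l: "[l] \<in> fp_words G n" and w: "w \<in> fp_words G n"
    using fp_words_Cons by blast+
  have "\<phi> (fp_class G n [l]) = letter_value H f x l"
  proof (cases l)
    case (VarInv i)
    then have i: "i \<in> {1..n}"
      using l by simp
    have "fp_class G n [VarInv i] \<otimes>\<^bsub>free_prod G n\<^esub> fp_var G n i = \<one>\<^bsub>free_prod G n\<^esub>"
      using i by (auto simp: fp_var_def G.mult_free_prod G.one_free_prod G.fp_class_eq_iff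
          intro: fp_cong.l_cancel)
    moreover have c: "fp_class G n [VarInv i] \<in> carrier (free_prod G n)"
      using i by (auto simp: G.carrier_free_prod)
    ultimately have "\<phi> (fp_class G n [VarInv i]) \<otimes>\<^bsub>H\<^esub> x i = \<one>\<^bsub>H\<^esub>"
      using \<phi>(3) i hom_mult[OF \<phi>(1) c G.fp_var_closed[OF i]] hom_one[OF \<phi>(1) F.is_group H]
      by metis
    moreover have "\<phi> (fp_class G n [VarInv i]) \<in> carrier H"
      using c \<phi>(1) by (simp add: hom_in_carrier)
    ultimately show ?thesis
      using x i VarInv H.inv_equality by (metis PiE letter_value.simps(3))
  qed (use l \<phi> in \<open>auto simp: fp_coef_def fp_var_def\<close>)
  moreover have "fp_class G n (l # w) = fp_class G n [l] \<otimes>\<^bsub>free_prod G n\<^esub> fp_class G n w"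
    using l w by (simp add: G.mult_free_prod)
  moreover have "fp_class G n [l] \<in> carrier (free_prod G n)" "fp_class G n w \<in> carrier (free_prod G n)"
    using l w by (auto simp: G.carrier_free_prod)
  ultimately show ?case
    using \<phi>(1) Cons.IH[OF w] by (simp add: hom_mult eval_word_Cons)
qed

lemma free_prod_universal:
  "\<exists>!\<phi>. \<phi> \<in> hom (free_prod G n) H \<and> \<phi> \<in> extensional (carrier (free_prod G n)) \<and>
     (\<forall>g\<in>carrier G. \<phi> (fp_coef G n g) = f g) \<and> (\<forall>i\<in>{1..n}. \<phi> (fp_var G n i) = x i)"
proof (rule ex_ex1I)
  define \<phi> where "\<phi> = restrict (\<lambda>A. eval_word H f x (SOME w. w \<in> A)) (carrier (free_prod G n))"
  have \<phi>: "\<phi> (fp_class G n w) = eval_word H f x w" if w: "w \<in> fp_words G n" for w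
  proof -
    have "w \<in> fp_class G n w"
      using w by (simp add: fp_class_def fp_cong.refl)
    then have "(SOME v. v \<in> fp_class G n w) \<in> fp_class G n w"
      by (rule someI)
    then have "eval_word H f x (SOME v. v \<in> fp_class G n w) = eval_word H f x w"
      using eval_word_cong by (simp add: fp_class_def)
    then show ?thesis
      using w by (auto simp: \<phi>_def G.carrier_free_prod)
  qed
  have "\<phi> \<in> hom (free_prod G n) H"
    by (rule homI)
       (auto simp: G.carrier_free_prod \<phi> G.mult_free_prod eval_word_closed eval_word_append)
  moreover have "\<phi> \<in> extensional (carrier (free_prod G n))"
    by (simp add: \<phi>_def)
  moreover have "\<forall>g\<in>carrier G. \<phi> (fp_coef G n g) = f g"
    using f by (simp add: fp_coef_def \<phi> eval_word_Cons eval_word_Nil hom_in_carrier)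
  moreover have "\<forall>i\<in>{1..n}. \<phi> (fp_var G n i) = x i"
    using x by (auto simp: fp_var_def \<phi> eval_word_Cons eval_word_Nil Pi_iff)
  ultimately show "\<exists>\<phi>. \<phi> \<in> hom (free_prod G n) H \<and> \<phi> \<in> extensional (carrier (free_prod G n)) \<and>
     (\<forall>g\<in>carrier G. \<phi> (fp_coef G n g) = f g) \<and> (\<forall>i\<in>{1..n}. \<phi> (fp_var G n i) = x i)"
    by blast
next
  fix \<phi> \<psi>
  assume *: "\<phi> \<in> hom (free_prod G n) H \<and> \<phi> \<in> extensional (carrier (free_prod G n)) \<and>
     (\<forall>g\<in>carrier G. \<phi> (fp_coef G n g) = f g) \<and> (\<forall>i\<in>{1..n}. \<phi> (fp_var G n i) = x i)"
    and **: "\<psi> \<in> hom (free_prod G n) H \<and> \<psi> \<in> extensional (carrier (free_prod G n)) \<and>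
     (\<forall>g\<in>carrier G. \<psi> (fp_coef G n g) = f g) \<and> (\<forall>i\<in>{1..n}. \<psi> (fp_var G n i) = x i)"
  show "\<phi> = \<psi>"
  proof (rule extensionalityI[of _ "carrier (free_prod G n)"])
    fix A assume "A \<in> carrier (free_prod G n)"
    then show "\<phi> A = \<psi> A"
      using * ** by (auto simp: G.carrier_free_prod hom_free_prod_eq_eval_word)
  qed (use * ** in auto)
qed

end

context group
begin

lemma subst_hom_ex1:
  assumes "x \<in> {1..n} \<rightarrow> carrier G"
  shows "\<exists>!\<phi>. \<phi> \<in> hom (free_prod G n) G \<and> \<phi> \<in> extensional (carrier (free_prod G n)) \<and>
     (\<forall>g\<in>carrier G. \<phi> (fp_coef G n g) = g) \<and> (\<forall>i\<in>{1..n}. \<phi> (fp_var G n i) = x i)"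
proof -
  have "(\<lambda>g. g) \<in> hom G G"
    by (simp add: hom_def)
  from free_prod_universal[OF is_group is_group this assms] show ?thesis .
qed

lemma subst_hom_class:
  assumes "x \<in> {1..n} \<rightarrow> carrier G" "w \<in> fp_words G n"
  shows "subst_hom G n x (fp_class G n w) = eval_word G (\<lambda>g. g) x w"
proof -
  have "(\<lambda>g. g) \<in> hom G G"
    by (simp add: hom_def)
  then show ?thesis
    using theI'[OF subst_hom_ex1[OF assms(1)], folded subst_hom_def] assms is_group
    by (intro hom_free_prod_eq_eval_word) auto
qed

end

text \<open>The sets counted by \<open>growth_fun\<close> are finite, so \<open>card\<close> is the number of their elements.\<close>

lemma finite_sphere:
  assumes S: "finite S" "word_generates G S" "\<forall>s\<in>S. 0 < \<omega> s" and V: "V \<subseteq> {1..n} \<rightarrow>\<^sub>E carrier G"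
  shows "finite {x \<in> V. tuple_weight G n S \<omega> x = m}"
proof -
  have len: "length w \<le> word_weight \<omega> w" if "w \<in> lists S" for w
    using that S(3) by (induction w) (auto simp: word_weight_def Suc_le_eq add_less_le_mono)
  let ?B = "word_value G ` {w. set w \<subseteq> S \<and> length w \<le> m}"
  have ball: "g \<in> ?B" if "g \<in> carrier G" "elem_weight G S \<omega> g \<le> m" for g
  proof -
    have "\<exists>k. \<exists>w\<in>lists S. word_value G w = g \<and> word_weight \<omega> w = k"
      using S(2) that(1) unfolding word_generates_def by blast
    from LeastI_ex[OF this, folded elem_weight_def]
    obtain w where "w \<in> lists S" "word_value G w = g" "word_weight \<omega> w = elem_weight G S \<omega> g"
      by blast
    then show ?thesis
      using len[of w] that(2) by auto
  qed
  have "{x \<in> V. tuple_weight G n S \<omega> x = m} \<subseteq> {1..n} \<rightarrow>\<^sub>E ?B"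
  proof
    fix x assume x: "x \<in> {x \<in> V. tuple_weight G n S \<omega> x = m}"
    then have xE: "x \<in> {1..n} \<rightarrow>\<^sub>E carrier G" and m: "tuple_weight G n S \<omega> x = m"
      using V by auto
    have "x i \<in> ?B" if i: "i \<in> {1..n}" for i
    proof (rule ball)
      show "x i \<in> carrier G"
        using xE i by (rule PiE_mem)
      show "elem_weight G S \<omega> (x i) \<le> m"
        unfolding m[symmetric] tuple_weight_def using i by (intro member_le_sum) auto
    qed
    then show "x \<in> {1..n} \<rightarrow>\<^sub>E ?B"
      using xE by (auto simp: PiE_iff)
  qed
  moreover have "finite ({1..n} \<rightarrow>\<^sub>E ?B)"
    using S(1) by (intro finite_PiE finite_imageI finite_lists_length_le) auto
  ultimately show ?thesis
    by (rule finite_subset)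
qed

end

theory Submission
  imports Defs "HOL-Library.Function_Algebras" "HOL-Algebra.FiniteProduct" "HOL-Algebra.Product_Groups"
begin

text \<open>
  The weight of a tuple is the least weight of a word representing it, so instead of the tuples of
  weight exactly \<open>m\<close> one may count the tuples of weight at most \<open>m\<close>; this only divides the series by
  \<open>1 - z\<close>. Adjoin to the alphabet a padding letter of value \<open>1\<close> and weight \<open>1\<close>. Then \<open>\<parallel>x\<parallel> \<le> m\<close> says
  that the pair \<open>(x, m)\<close> is the value and the weight of some word, in the group \<open>P = G\<^sup>n\<close> where
  the other letters stand for the elements of \<open>S\<close> placed in one of the \<open>n\<close> coordinates. No minimality
  is left: the task is to count the pairs that are attained by words and whose first component lies in \<open>V\<close>.

  A virtually abelian group has an abelian normal subgroup \<open>N\<close> of finite index; its power is such a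
  subgroup of \<open>P\<close>. Choose representatives \<open>q\<close> of the cosets. A word is a walk in the finite graph whose
  vertices are these representatives and whose edges \<open>e = (q, s)\<close> lead from \<open>q\<close> to the representative
  \<open>q'\<close> of \<open>q s\<close>. The Schreier elements \<open>q s q'\<inverse>\<close> lie in the abelian group \<open>N\<close>, so the value of the word
  depends only on its last vertex and on how often each edge is used: it is a product of powers of
  Schreier elements, with these numbers as exponents (\<open>walk_value\<close>). The exponent vectors of walks with
  given support and given ends form a finite union of translates of a set of circulations, since a
  circulation can be absorbed into any walk that uses all its edges, in the manner of Euler's theorem
  (\<open>walk_absorbs_circulation\<close>, \<open>walk_counts_decomposition\<close>).

  Circulations form a flat set of vectors, meaning that \<open>p + q = r + s\<close> and \<open>p, q, r \<in> D\<close> imply \<open>s \<in> D\<close>;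
  and on them the value satisfies \<open>f s = f p (f r)\<inverse> f q\<close>. Inside cosets of \<open>N\<close> the evaluation of a word
  with coefficients respects the operation \<open>a b\<inverse> c\<close> as well (\<open>heap_eval_word\<close>), so \<open>V\<close> is closed under
  it (\<open>algebraic_set_heap\<close>), and the condition that the value lies in \<open>V\<close> again cuts out a flat set.
  Hence the set of pairs is a finite union of images of flat sets under maps compatible with one
  ternary operation. For two such maps the equation \<open>f u = f' v\<close> also describes a flat set, so these
  images are closed under intersection (\<open>flat_image_Int\<close>) and inclusion and exclusion reduces the
  problem to a single image.

  By Dickson's lemma a flat set is a finite union of translates of a finitely generated monoid. Adding a
  generator of the monoid induces an injective map of the image that raises the weight by a positive
  constant, and the image is the orbit of a finite set under finitely many such commuting maps. For
  orbits rationality is the Hilbert--Serre argument: \<open>F(X) (1 - z\<^sup>w) = F(Z) - F(Z \<inter> h X)\<close>, where \<open>Z\<close> is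
  generated without \<open>h\<close>, and where \<open>Z \<inter> h X\<close> is again an orbit of a finite set by a version of Hilbert's
  basis theorem (\<open>orbit_noetherian\<close>, \<open>rational_weight_series_orbit\<close>).
\<close>

section \<open>Rational power series\<close>

definition weight_series :: "('x \<Rightarrow> nat) \<Rightarrow> 'x set \<Rightarrow> rat fps" where
  "weight_series l X = Abs_fps (\<lambda>m. of_nat (card {x \<in> X. l x = m}))"

definition finite_levels :: "('x \<Rightarrow> nat) \<Rightarrow> 'x set \<Rightarrow> bool" where
  "finite_levels l X \<longleftrightarrow> (\<forall>m. finite {x \<in> X. l x = m})"

lemma finite_levels_subset:
  assumes "finite_levels l Y" "X \<subseteq> Y"
  shows "finite_levels l X"
  unfolding finite_levels_def
proof
  fix m
  show "finite {x \<in> X. l x = m}"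
    by (rule finite_subset[of _ "{x \<in> Y. l x = m}"]) (use assms in \<open>auto simp: finite_levels_def\<close>)
qed

lemma rational_fps_add: "rational_fps F \<Longrightarrow> rational_fps K \<Longrightarrow> rational_fps (F + K)"
proof -
  assume "rational_fps F" "rational_fps K"
  then obtain p q p' q' where *: "q \<noteq> 0" "F * fps_of_poly q = fps_of_poly p"
    "q' \<noteq> 0" "K * fps_of_poly q' = fps_of_poly p'"
    unfolding rational_fps_iff by blast
  have "(F + K) * fps_of_poly (q * q')
      = (F * fps_of_poly q) * fps_of_poly q' + (K * fps_of_poly q') * fps_of_poly q"
    by (simp add: fps_of_poly_mult algebra_simps)
  also have "\<dots> = fps_of_poly (p * q' + p' * q)"
    using * by (simp add: fps_of_poly_mult fps_of_poly_add)
  finally show ?thesis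
    using * unfolding rational_fps_iff by (intro exI[of _ "p * q' + p' * q"] exI[of _ "q * q'"]) simp
qed

lemma rational_fps_mult_poly:
  assumes "rational_fps F"
  shows "rational_fps (F * fps_of_poly p)"
proof -
  obtain r q where *: "q \<noteq> 0" "F * fps_of_poly q = fps_of_poly r"
    using assms unfolding rational_fps_iff by blast
  have "F * fps_of_poly p * fps_of_poly q = (F * fps_of_poly q) * fps_of_poly p"
    by (simp only: mult_ac)
  also have "\<dots> = fps_of_poly (r * p)"
    using * by (simp add: fps_of_poly_mult)
  finally show ?thesis
    using * unfolding rational_fps_iff by blast
qed

lemma rational_fps_diff: "rational_fps F \<Longrightarrow> rational_fps K \<Longrightarrow> rational_fps (F - K)"
  using rational_fps_add[of F "K * fps_of_poly (- 1)"] rational_fps_mult_poly[of K "- 1"]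
  by (simp add: fps_of_poly_uminus)

lemma rational_fps_div_poly:
  assumes "rational_fps (F * fps_of_poly q)" "q \<noteq> 0"
  shows "rational_fps F"
proof -
  obtain r q' where *: "q' \<noteq> 0" "F * fps_of_poly q * fps_of_poly q' = fps_of_poly r"
    using assms(1) unfolding rational_fps_iff by blast
  then have "F * fps_of_poly (q * q') = fps_of_poly r"
    by (simp add: fps_of_poly_mult mult.assoc)
  moreover have "q * q' \<noteq> 0"
    using * assms(2) by simp
  ultimately show ?thesis
    unfolding rational_fps_iff by blast
qed

lemma rational_weight_series_finite:
  assumes "finite X"
  shows "rational_fps (weight_series l X)"
proof -
  have "weight_series l X = fps_of_poly (\<Sum>x\<in>X. monom 1 (l x))"
    by (rule fps_ext)
       (simp add: weight_series_def coeff_sum if_distrib sum.If_cases[OF assms] Int_def conj_commute eq_commute)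
  then show ?thesis
    unfolding rational_fps_iff by (intro exI[of _ "\<Sum>x\<in>X. monom 1 (l x)"] exI[of _ 1]) simp
qed

lemma weight_series_Un:
  assumes "finite_levels l X" "finite_levels l Y"
  shows "weight_series l (X \<union> Y) = weight_series l X + weight_series l Y - weight_series l (X \<inter> Y)"
proof (rule fps_ext)
  fix m
  let ?A = "{x \<in> X. l x = m}" and ?B = "{x \<in> Y. l x = m}"
  have *: "{x \<in> X \<union> Y. l x = m} = ?A \<union> ?B" "{x \<in> X \<inter> Y. l x = m} = ?A \<inter> ?B"
    by auto
  have "card ?A + card ?B = card (?A \<union> ?B) + card (?A \<inter> ?B)"
    using assms by (intro card_Un_Int) (auto simp: finite_levels_def)
  then have "(of_nat (card ?A) + of_nat (card ?B) :: rat)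
      = of_nat (card (?A \<union> ?B)) + of_nat (card (?A \<inter> ?B))"
    by (simp flip: of_nat_add)
  then show "fps_nth (weight_series l (X \<union> Y)) m
      = fps_nth (weight_series l X + weight_series l Y - weight_series l (X \<inter> Y)) m"
    unfolding weight_series_def * fps_sub_nth fps_add_nth fps_nth_Abs_fps
    by simp
qed

text \<open>Closure of the family under intersection replaces the alternating sum of inclusion and exclusion by
  an induction: adjoining \<open>X j\<close> to a union costs the series of the union of the sets \<open>X i \<inter> X j\<close>, which
  has one member fewer.\<close>

lemma rational_weight_series_UN:
  assumes inter: "\<And>X Y. X \<in> C \<Longrightarrow> Y \<in> C \<Longrightarrow> X \<inter> Y \<in> C"
    and lev: "\<And>X. X \<in> C \<Longrightarrow> finite_levels l X"
    and rat: "\<And>X. X \<in> C \<Longrightarrow> rational_fps (weight_series l X)"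
    and I: "finite I" "\<And>i. i \<in> I \<Longrightarrow> X i \<in> C"
  shows "rational_fps (weight_series l (\<Union>i\<in>I. X i)) \<and> finite_levels l (\<Union>i\<in>I. X i)"
  using I
proof (induction I arbitrary: X rule: finite_induct)
  case empty
  then show ?case
    by (simp add: rational_weight_series_finite finite_levels_def)
next
  case (insert j I)
  let ?U = "\<Union>i\<in>I. X i"
  have U: "rational_fps (weight_series l ?U)" "finite_levels l ?U"
    using insert by auto
  have "?U \<inter> X j = (\<Union>i\<in>I. X i \<inter> X j)"
    by auto
  then have "rational_fps (weight_series l (?U \<inter> X j))"
    using insert.IH[of "\<lambda>i. X i \<inter> X j"] insert.prems inter by simp
  then have "rational_fps (weight_series l (?U \<union> X j))"
    using U insert.prems lev rat
    by (auto simp: weight_series_Un intro!: rational_fps_diff rational_fps_add)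
  moreover have "finite_levels l (?U \<union> X j)"
  proof -
    have "finite {x \<in> ?U \<union> X j. l x = m}" for m
    proof -
      have "{x \<in> ?U \<union> X j. l x = m} = {x \<in> ?U. l x = m} \<union> {x \<in> X j. l x = m}"
        by auto
      then show ?thesis
        using U lev[of "X j"] insert.prems by (simp add: finite_levels_def)
    qed
    then show ?thesis
      by (simp add: finite_levels_def)
  qed
  ultimately show ?case
    by (simp add: Un_commute)
qed

section \<open>Orbits of commuting maps\<close>

inductive_set orbit :: "('x \<Rightarrow> 'x) set \<Rightarrow> 'x set \<Rightarrow> 'x set" for H and X where
  orbit_base: "x \<in> X \<Longrightarrow> x \<in> orbit H X"
| orbit_step: "x \<in> orbit H X \<Longrightarrow> h \<in> H \<Longrightarrow> h x \<in> orbit H X"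

lemma orbit_least:
  assumes "X \<subseteq> Y" "\<And>h y. h \<in> H \<Longrightarrow> y \<in> Y \<Longrightarrow> h y \<in> Y"
  shows "orbit H X \<subseteq> Y"
proof
  fix x assume "x \<in> orbit H X"
  then show "x \<in> Y"
    by induction (use assms in auto)
qed

lemma orbit_mono: "H \<subseteq> H' \<Longrightarrow> X \<subseteq> X' \<Longrightarrow> orbit H X \<subseteq> orbit H' X'"
  by (intro orbit_least) (auto intro: orbit.intros)

lemma orbit_empty: "orbit {} X = X"
  using orbit_least[of X X "{}"] by (auto intro: orbit.intros)

lemma orbit_funpow: "x \<in> orbit H X \<Longrightarrow> h \<in> H \<Longrightarrow> (h ^^ k) x \<in> orbit H X"
  by (induction k) (auto intro: orbit.intros)

definition commute_on :: "'x set \<Rightarrow> ('x \<Rightarrow> 'x) set \<Rightarrow> bool" where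
  "commute_on X H \<longleftrightarrow> (\<forall>h\<in>H. \<forall>g\<in>H. \<forall>x\<in>X. h (g x) = g (h x))"

lemma commute_on_mono: "commute_on X H \<Longrightarrow> Y \<subseteq> X \<Longrightarrow> H' \<subseteq> H \<Longrightarrow> commute_on Y H'"
  unfolding commute_on_def by blast

lemma commute_funpow:
  assumes "commute_on (orbit H X) H" "g \<in> H" "h \<in> H" "x \<in> orbit H X"
  shows "(h ^^ k) (g x) = g ((h ^^ k) x)"
proof (induction k)
  case (Suc k)
  then show ?case
    using assms orbit_funpow[OF assms(4,3), of k] by (simp add: commute_on_def)
qed simp

lemma orbit_insert:
  assumes comm: "commute_on (orbit (insert h H) X) (insert h H)" and x: "x \<in> orbit (insert h H) X"
  shows "\<exists>k. \<exists>z\<in>orbit H X. x = (h ^^ k) z"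
  using x
proof induction
  case (orbit_base x)
  then show ?case
    by (intro exI[of _ 0]) (auto intro: orbit.intros)
next
  case (orbit_step x g)
  then obtain k z where kz: "z \<in> orbit H X" "x = (h ^^ k) z"
    by blast
  then have z: "z \<in> orbit (insert h H) X"
    using orbit_mono[of H "insert h H" X X] by auto
  show ?case
  proof (cases "g = h")
    case True
    then show ?thesis
      using kz by (intro exI[of _ "Suc k"]) auto
  next
    case False
    then have "g z \<in> orbit H X" "(h ^^ k) (g z) = g x"
      using orbit_step.hyps kz z commute_funpow[OF comm] by (auto intro: orbit.intros)
    then show ?thesis
      by metis
  qed
qed

text \<open>Hilbert's basis theorem for orbits, with the same proof: the set \<open>L k\<close> of all \<open>z\<close>
  with \<open>h\<^sup>k z \<in> Y\<close> plays the part of the leading coefficients of degree \<open>k\<close>. These sets increase with \<open>k\<close>,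
  and their union is finitely generated by induction, so they are constant from some \<open>M\<close> on. The
  elements \<open>h\<^sup>k b\<close>, with \<open>b\<close> among generators of \<open>L k\<close> and \<open>k \<le> M\<close>, then generate \<open>Y\<close>.\<close>

lemma orbit_noetherian:
  assumes "finite H" "finite X" "commute_on (orbit H X) H"
    and "Y \<subseteq> orbit H X" "\<And>h y. h \<in> H \<Longrightarrow> y \<in> Y \<Longrightarrow> h y \<in> Y"
  shows "\<exists>Y0. finite Y0 \<and> Y = orbit H Y0"
  using assms
proof (induction H arbitrary: Y rule: finite_induct)
  case empty
  then show ?case
    by (auto simp: orbit_empty finite_subset)
next
  case (insert h H)
  let ?O = "orbit (insert h H) X"
  define Z where "Z = orbit H X"
  define L where "L k = {z \<in> Z. (h ^^ k) z \<in> Y}" for k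
  have ZO: "Z \<subseteq> ?O"
    unfolding Z_def by (intro orbit_mono) auto
  have commH: "commute_on (orbit H X) H"
    using insert.prems(2) ZO unfolding Z_def by (rule commute_on_mono) auto
  have L_closed: "g z \<in> L k" if "g \<in> H" "z \<in> L k" for g z k
    using that ZO commute_funpow[OF insert.prems(2), of g h z k] insert.prems(4)
    by (auto simp: L_def Z_def intro: orbit.intros)
  have L_Suc: "L k \<subseteq> L (Suc k)" for k
    using insert.prems(4) by (auto simp: L_def)
  have L_mono: "L i \<subseteq> L j" if "i \<le> j" for i j
    using L_Suc that by (rule lift_Suc_mono_le)
  have LZ: "L k \<subseteq> orbit H X" for k
    by (auto simp: L_def Z_def)
  have "\<exists>B. finite B \<and> L k = orbit H B" for k
    by (rule insert.IH[OF insert.prems(1) commH LZ]) (rule L_closed)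
  then obtain B where B: "\<And>k. finite (B k)" "\<And>k. L k = orbit H (B k)"
    by metis
  have "(\<Union>k. L k) \<subseteq> orbit H X"
    using LZ by auto
  then have "\<exists>U. finite U \<and> (\<Union>k. L k) = orbit H U"
    by (rule insert.IH[OF insert.prems(1) commH]) (auto intro: L_closed)
  then obtain U where U: "finite U" "(\<Union>k. L k) = orbit H U"
    by blast
  have "\<forall>u\<in>U. \<exists>k. u \<in> L k"
    using U(2) by (auto intro: orbit.intros)
  then obtain \<kappa> where \<kappa>: "\<And>u. u \<in> U \<Longrightarrow> u \<in> L (\<kappa> u)"
    by metis
  define M where "M = Max (insert 0 (\<kappa> ` U))"
  have "U \<subseteq> L M"
    using U(1) \<kappa> L_mono by (auto simp: M_def intro!: subsetD[OF L_mono \<kappa>])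
  then have LM: "L k \<subseteq> L M" for k
    using orbit_least[of U "L M" H] L_closed U(2) by blast
  define Y0 where "Y0 = (\<Union>k\<le>M. (h ^^ k) ` B k)"
  have "Y0 \<subseteq> Y"
    using B(2) by (auto simp: Y0_def L_def intro: orbit.intros)
  then have "orbit (insert h H) Y0 \<subseteq> Y"
    using insert.prems(4) by (intro orbit_least) auto
  moreover have "y \<in> orbit (insert h H) Y0" if y: "y \<in> Y" for y
  proof -
    obtain k z where kz: "z \<in> orbit H X" "y = (h ^^ k) z"
      using orbit_insert[OF insert.prems(2), of y] insert.prems(3) y by blast
    have lift: "(h ^^ j) z \<in> orbit (insert h H) Y0" if "z \<in> L j" "j \<le> M" for j
    proof -
      have "z \<in> orbit H (B j)"
        using that B by auto
      then show ?thesis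
      proof induction
        case (orbit_base x)
        then show ?case
          using that by (auto simp: Y0_def intro: orbit.orbit_base)
      next
        case (orbit_step x g)
        have "x \<in> ?O"
          using orbit_step.hyps B(2) ZO by (auto simp: L_def)
        then show ?case
          using orbit_step commute_funpow[OF insert.prems(2), of g h x j]
          by (auto intro: orbit.orbit_step)
      qed
    qed
    have zk: "z \<in> L k"
      using kz y by (simp add: L_def Z_def)
    show ?thesis
    proof (cases "k \<le> M")
      case True
      then show ?thesis
        using lift zk kz by simp
    next
      case False
      then have "y = (h ^^ (k - M)) ((h ^^ M) z)"
        using kz by (simp flip: funpow_add comp_apply[of "h ^^ _"])
      then show ?thesis
        using lift[of M] zk LM by (auto intro: orbit_funpow)
    qed
  qed
  ultimately have "Y = orbit (insert h H) Y0"
    by blast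
  moreover have "finite Y0"
    using B(1) by (simp add: Y0_def)
  ultimately show ?case
    by blast
qed

lemma finite_levels_orbit:
  assumes "finite H" "finite X"
    and wt: "\<And>h x. h \<in> H \<Longrightarrow> x \<in> orbit H X \<Longrightarrow> l x < l (h x)"
  shows "finite_levels l (orbit H X)"
proof -
  have "finite {x \<in> orbit H X. l x < m}" for m
  proof (induction m)
    case (Suc m)
    have "{x \<in> orbit H X. l x < Suc m} \<subseteq> X \<union> (\<Union>h\<in>H. h ` {x \<in> orbit H X. l x < m})"
    proof
      fix x assume "x \<in> {x \<in> orbit H X. l x < Suc m}"
      then have "x \<in> orbit H X" "l x < Suc m"
        by auto
      then show "x \<in> X \<union> (\<Union>h\<in>H. h ` {x \<in> orbit H X. l x < m})"
      proof cases
        case (orbit_step y h)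
        then have "l y < m"
          using wt[of h y] \<open>l x < Suc m\<close> by simp
        then show ?thesis
          using orbit_step by blast
      qed simp
    qed
    then show ?case
      using Suc assms by (auto elim: finite_subset)
  qed simp
  then have "finite {x \<in> orbit H X. l x = m}" for m
    by (rule finite_subset[rotated, OF spec[of _ "Suc m", OF allI]]) auto
  then show ?thesis
    by (simp add: finite_levels_def)
qed

text \<open>The Hilbert--Serre argument. As \<open>h\<close> is injective and raises the weight by \<open>w\<close>, the image of the
  orbit \<open>X\<close> has the series \<open>z\<^sup>w F(X)\<close>. What lies outside this image is reached without \<open>h\<close>, so with
  \<open>Z\<close> generated by the remaining maps, \<open>F(X) - z\<^sup>w F(X) = F(Z) - F(Z \<inter> h X)\<close>, and both sets on the right
  are orbits for fewer maps.\<close>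

lemma rational_weight_series_orbit:
  assumes "finite H" "finite X" "commute_on (orbit H X) H"
    and "\<And>h. h \<in> H \<Longrightarrow> inj_on h (orbit H X)"
    and "\<And>h. h \<in> H \<Longrightarrow> \<exists>w>0. \<forall>x\<in>orbit H X. l (h x) = l x + w"
  shows "rational_fps (weight_series l (orbit H X))"
  using assms
proof (induction H arbitrary: X rule: finite_induct)
  case empty
  then show ?case
    by (simp add: orbit_empty rational_weight_series_finite)
next
  case (insert h H)
  let ?O = "orbit (insert h H) X"
  define Z where "Z = orbit H X"
  define Y where "Y = Z \<inter> h ` ?O"
  have ZO: "Z \<subseteq> ?O"
    unfolding Z_def by (intro orbit_mono) auto
  have commH: "commute_on (orbit H X) H"
    using insert.prems(2) ZO unfolding Z_def by (rule commute_on_mono) auto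
  have hO: "g x \<in> h ` ?O" if gx: "g \<in> insert h H" "x \<in> h ` ?O" for g x
  proof -
    obtain x' where x': "x' \<in> ?O" "x = h x'"
      using gx(2) by blast
    then have "g x = h (g x')"
      using gx(1) insert.prems(2) unfolding commute_on_def by blast
    then show ?thesis
      using x' gx(1) by (auto intro: orbit.intros)
  qed
  have sub: "rational_fps (weight_series l (orbit H B))" if "orbit H B \<subseteq> Z" "finite B" for B
  proof (rule insert.IH)
    show "commute_on (orbit H B) H"
      using commH that Z_def by (auto intro: commute_on_mono)
  next
    fix g assume g: "g \<in> H"
    show "inj_on g (orbit H B)"
      using insert.prems(3)[of g] g that(1) ZO by (auto intro: inj_on_subset)
    show "\<exists>w>0. \<forall>x\<in>orbit H B. l (g x) = l x + w"
      using insert.prems(4)[of g] g that(1) ZO by (meson insertCI subsetD)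
  qed (use that in simp)
  have "\<exists>B. finite B \<and> Y = orbit H B"
    by (rule orbit_noetherian[OF insert.hyps(1) insert.prems(1) commH])
       (use hO in \<open>auto simp: Y_def Z_def intro: orbit.intros\<close>)
  then have ratY: "rational_fps (weight_series l Y)"
    using sub by (metis Y_def inf_le1)
  have ratZ: "rational_fps (weight_series l Z)"
    using sub[of X] insert.prems(1) by (simp add: Z_def)
  have OZ: "?O = Z \<union> h ` ?O"
  proof -
    have "?O \<subseteq> Z \<union> h ` ?O"
    proof
      fix x assume "x \<in> ?O"
      then show "x \<in> Z \<union> h ` ?O"
      proof induction
        case (orbit_base x)
        then show ?case
          by (auto simp: Z_def intro: orbit.intros)
      next
        case (orbit_step x g)
        then show ?case
          using hO[of g x] by (auto simp: Z_def intro: orbit.intros)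
      qed
    qed
    then show ?thesis
      using ZO by (auto intro: orbit.intros)
  qed
  obtain w where w: "w > 0" "\<forall>x\<in>?O. l (h x) = l x + w"
    using insert.prems(4) by blast
  have lev: "finite_levels l ?O"
  proof (rule finite_levels_orbit)
    fix g x assume "g \<in> insert h H" "x \<in> ?O"
    then show "l x < l (g x)"
      using insert.prems(4)[of g] by auto
  qed (use insert.prems(1) insert.hyps(1) in auto)
  have shift: "weight_series l (h ` ?O) = weight_series l ?O * fps_of_poly (monom 1 w)"
  proof (rule fps_ext)
    fix m
    have "{y \<in> h ` ?O. l y = m} = (if m < w then {} else h ` {x \<in> ?O. l x = m - w})"
      using w by auto
    moreover have "card (h ` {x \<in> ?O. l x = m - w}) = card {x \<in> ?O. l x = m - w}"
      using insert.prems(3)[of h] by (intro card_image) (auto intro: inj_on_subset)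
    ultimately show "fps_nth (weight_series l (h ` ?O)) m
        = fps_nth (weight_series l ?O * fps_of_poly (monom 1 w)) m"
      by (simp add: weight_series_def fps_of_poly_monom fps_X_power_mult_right_nth)
  qed
  have "weight_series l ?O = weight_series l Z + weight_series l (h ` ?O) - weight_series l Y"
    using weight_series_Un[of l Z "h ` ?O"] OZ lev
    by (metis Y_def finite_levels_subset Un_upper1 Un_upper2)
  then have "weight_series l ?O * fps_of_poly (1 - monom 1 w) = weight_series l Z - weight_series l Y"
    unfolding shift by (simp add: fps_of_poly_diff algebra_simps)
  moreover have "(1 - monom 1 w :: rat poly) \<noteq> 0"
  proof -
    have "coeff (1 - monom 1 w :: rat poly) 0 = 1"
      using w by simp
    then show ?thesis
      by force
  qed
  ultimately show ?case
    using ratZ ratY by (metis rational_fps_diff rational_fps_div_poly)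
qed

section \<open>Flat sets of exponent vectors and their images\<close>

definition vectors :: "'e set \<Rightarrow> ('e \<Rightarrow> nat) set" where
  "vectors E = {u. \<forall>e. e \<notin> E \<longrightarrow> u e = 0}"

lemma vectors_summand:
  assumes "p \<in> vectors E" "q \<in> vectors E" "p + q = r + s"
  shows "s \<in> vectors E"
  unfolding vectors_def
proof (intro CollectI allI impI)
  fix e assume "e \<notin> E"
  moreover have "p e + q e = r e + s e"
    using fun_cong[OF assms(3), of e] by simp
  ultimately show "s e = 0"
    using assms(1,2) by (simp add: vectors_def)
qed

text \<open>This makes Dickson's lemma an instance of \<open>orbit_noetherian\<close>.\<close>

lemma vectors_eq_orbit:
  assumes "finite E"
  shows "vectors E = orbit ((\<lambda>e u. u(e := Suc (u e))) ` E) {0}"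
proof
  let ?H = "(\<lambda>e u. u(e := Suc (u e))) ` E :: (('a \<Rightarrow> nat) \<Rightarrow> 'a \<Rightarrow> nat) set"
  show "orbit ?H {0} \<subseteq> vectors E"
    by (rule orbit_least) (auto simp: vectors_def)
  show "vectors E \<subseteq> orbit ?H {0}"
  proof
    fix u :: "'a \<Rightarrow> nat" assume "u \<in> vectors E"
    then show "u \<in> orbit ?H {0}"
    proof (induction "sum u E" arbitrary: u)
      case 0
      then have "u = 0"
        using assms by (auto simp: vectors_def fun_eq_iff)
      then show ?case
        by (simp add: orbit.orbit_base)
    next
      case (Suc k)
      then obtain e where e: "e \<in> E" "u e \<noteq> 0"
        by (metis nat.distinct(1) sum.neutral)
      define v where "v = u(e := u e - 1)"
      have "sum u E = Suc (sum v E)"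
        using e assms by (simp add: v_def sum.remove[of E e])
      moreover have "v \<in> vectors E"
        using Suc.prems by (auto simp: v_def vectors_def)
      ultimately have "v \<in> orbit ?H {0}"
        using Suc by simp
      moreover have "u = v(e := Suc (v e))"
        using e by (auto simp: v_def)
      ultimately show ?case
        using e(1) orbit.orbit_step[of v ?H "{0}" "\<lambda>u. u(e := Suc (u e))"] by auto
    qed
  qed
qed

lemma dickson:
  assumes "finite E" "D \<subseteq> vectors E"
  obtains M where "finite M" "M \<subseteq> D" "\<And>d. d \<in> D \<Longrightarrow> \<exists>m\<in>M. m \<le> d"
proof -
  let ?H = "(\<lambda>e u. u(e := Suc (u e))) ` E :: (('a \<Rightarrow> nat) \<Rightarrow> 'a \<Rightarrow> nat) set"
  define Y where "Y = {u \<in> vectors E. \<exists>d\<in>D. d \<le> u}"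
  have "commute_on (orbit ?H {0}) ?H"
    by (auto simp: commute_on_def fun_eq_iff)
  moreover have "Y \<subseteq> orbit ?H {0}"
    using vectors_eq_orbit[OF assms(1)] by (auto simp: Y_def)
  moreover have "h u \<in> Y" if h: "h \<in> ?H" and u: "u \<in> Y" for h u
  proof -
    obtain e where e: "e \<in> E" "h = (\<lambda>u. u(e := Suc (u e)))"
      using h by auto
    have "u \<le> h u"
      using e by (auto simp: le_fun_def)
    moreover have "h u \<in> vectors E"
      using u e by (auto simp: Y_def vectors_def)
    ultimately show ?thesis
      using u order_trans by (auto simp: Y_def)
  qed
  ultimately have "\<exists>B. finite B \<and> Y = orbit ?H B"
    using assms(1) by (intro orbit_noetherian[of _ "{0}"]) auto
  then obtain B where B: "finite B" "Y = orbit ?H B"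
    by blast
  have "\<forall>b\<in>B. \<exists>d\<in>D. d \<le> b"
    using B(2) by (auto simp: Y_def dest: orbit.orbit_base[of _ B ?H])
  then obtain \<mu> where \<mu>: "\<And>b. b \<in> B \<Longrightarrow> \<mu> b \<in> D \<and> \<mu> b \<le> b"
    by metis
  have above: "\<exists>m\<in>\<mu> ` B. m \<le> u" if "u \<in> orbit ?H B" for u
    using that
  proof induction
    case (orbit_step u h)
    then have "u \<le> h u"
      by (auto simp: le_fun_def)
    then show ?case
      using orbit_step order_trans by blast
  qed (use \<mu> in auto)
  have "\<exists>m\<in>\<mu> ` B. m \<le> d" if "d \<in> D" for d
    using that assms(2) B(2) by (intro above) (auto simp: Y_def)
  then show ?thesis
    using that[of "\<mu> ` B"] B(1) \<mu> by blast
qed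

text \<open>Closure under \<open>p + q - r\<close> as far as this has no negative entries; the model is the trace of a coset of
  a subgroup of the integer vectors.\<close>

definition flat :: "('e \<Rightarrow> nat) set \<Rightarrow> bool" where
  "flat D \<longleftrightarrow> (\<forall>p\<in>D. \<forall>q\<in>D. \<forall>r\<in>D. \<forall>s. p + q = r + s \<longrightarrow> s \<in> D)"

lemma flatD: "flat D \<Longrightarrow> p \<in> D \<Longrightarrow> q \<in> D \<Longrightarrow> r \<in> D \<Longrightarrow> p + q = r + s \<Longrightarrow> s \<in> D"
  unfolding flat_def by blast

text \<open>The ternary operation \<open>t\<close> stands for \<open>a b\<inverse> c\<close> in a group; its purpose is that the values at
  \<open>p, r, q\<close> determine the value at \<open>p + q - r\<close>. Strict monotonicity of the weight concerns comparable
  members of \<open>D\<close> rather than single coordinates: after an intersection some coordinates carry no weight of their own.\<close>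

definition flat_map :: "('x \<Rightarrow> 'x \<Rightarrow> 'x \<Rightarrow> 'x) \<Rightarrow> ('x \<Rightarrow> nat) \<Rightarrow> ('e \<Rightarrow> nat) set \<Rightarrow> (('e \<Rightarrow> nat) \<Rightarrow> 'x) \<Rightarrow> bool"
  where "flat_map t l D f \<longleftrightarrow>
    (\<forall>p\<in>D. \<forall>q\<in>D. \<forall>r\<in>D. \<forall>s\<in>D. p + q = r + s \<longrightarrow>
       f s = t (f p) (f r) (f q) \<and> l (f p) + l (f q) = l (f r) + l (f s)) \<and>
    (\<forall>p\<in>D. \<forall>q\<in>D. p \<le> q \<longrightarrow> p \<noteq> q \<longrightarrow> l (f p) < l (f q))"

lemma flat_mapD:
  assumes "flat_map t l D f" "p \<in> D" "q \<in> D" "r \<in> D" "s \<in> D" "p + q = r + s"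
  shows "f s = t (f p) (f r) (f q)" "l (f p) + l (f q) = l (f r) + l (f s)"
  using assms unfolding flat_map_def by blast+

lemma flat_map_less:
  "flat_map t l D f \<Longrightarrow> p \<in> D \<Longrightarrow> q \<in> D \<Longrightarrow> p \<le> q \<Longrightarrow> p \<noteq> q \<Longrightarrow> l (f p) < l (f q)"
  unfolding flat_map_def by blast

text \<open>Here \<open>K\<close> is the monoid of all differences of \<open>d0\<close> with larger members of \<open>D\<close>; by flatness it does
  not depend on \<open>d0\<close>, and it contains the difference of any two comparable members of itself. Dickson's
  lemma provides finite sets \<open>B\<close> and \<open>M\<close> that contain a lower bound for each nonzero member of \<open>K\<close> and for
  each member of \<open>D\<close>; subtracting these bounds shows that \<open>B\<close> generates \<open>K\<close> and that \<open>D = M + K\<close>. A generator \<open>b\<close> acts on \<open>f ` D\<close> by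
  \<open>f u \<mapsto> f (u + b) = t (f u) (f d0) (f (d0 + b))\<close>; the formula shows that the action is well defined,
  and the analogous formula for \<open>f u\<close> in terms of \<open>f (u + b)\<close> shows that it is injective.\<close>

lemma flat_image_series:
  fixes D :: "('e \<Rightarrow> nat) set"
  assumes E: "finite E" "D \<subseteq> vectors E" and D: "flat D" and f: "flat_map t l D f"
  shows "rational_fps (weight_series l (f ` D)) \<and> finite_levels l (f ` D)"
proof (cases "D = {}")
  case True
  then show ?thesis
    by (simp add: rational_weight_series_finite finite_levels_def)
next
  case False
  then obtain d0 where d0: "d0 \<in> D"
    by blast
  define K where "K = {k. d0 + k \<in> D}"
  have DK: "d + k \<in> D" if "d \<in> D" "k \<in> K" for d k
    using flatD[OF D, of d "d0 + k" d0 "d + k"] that d0 by (simp add: K_def algebra_simps)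
  have KD: "k \<in> K" if "d \<in> D" "d + k \<in> D" for d k
    using flatD[OF D, of d0 "d + k" d "d0 + k"] that d0 by (simp add: K_def algebra_simps)
  have K_diff: "k' \<in> K" if "k \<in> K" "k + k' \<in> K" for k k'
    using KD[of "d0 + k" k'] that by (simp add: K_def add.assoc)
  have K_vec: "K \<subseteq> vectors E"
    using E(2) d0 by (auto simp: K_def vectors_def subset_iff)
  obtain M where M: "finite M" "M \<subseteq> D" "\<And>d. d \<in> D \<Longrightarrow> \<exists>m\<in>M. m \<le> d"
    using dickson[OF E] by blast
  obtain B where B: "finite B" "B \<subseteq> K - {0}" "\<And>k. k \<in> K - {0} \<Longrightarrow> \<exists>b\<in>B. b \<le> k"
    using dickson[OF E(1), of "K - {0}"] K_vec by blast
  define h where "h b x = t x (f d0) (f (d0 + b))" for b x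
  have h: "h b (f u) = f (u + b)" if "u \<in> D" "b \<in> K" for u b
  proof -
    have "d0 + b \<in> D" "u + b \<in> D" "u + (d0 + b) = d0 + (u + b)"
      using that d0 DK[of d0 b] DK[of u b] by (simp_all add: add.left_commute)
    then show ?thesis
      using flat_mapD(1)[OF f that(1) _ d0] by (simp add: h_def)
  qed
  have le_split: "\<exists>k. v = u + k" if "u \<le> v" for u v :: "'e \<Rightarrow> nat"
    using that by (intro exI[of _ "\<lambda>e. v e - u e"]) (auto simp: le_fun_def fun_eq_iff)
  have gen: "f (m + k) \<in> orbit (h ` B) (f ` M)" if "m \<in> M" "k \<in> K" for m k
    using that(2)
  proof (induction "sum k E" arbitrary: k rule: less_induct)
    case less
    show ?case
    proof (cases "k = 0")
      case True
      then show ?thesis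
        using that(1) by (auto intro: orbit.orbit_base)
    next
      case False
      then obtain b where b: "b \<in> B" "b \<le> k"
        using B(3) less.prems by blast
      then obtain k' where k': "k = b + k'"
        using le_split by blast
      have bK: "b \<in> K" "b \<noteq> 0" "b \<in> vectors E"
        using b B(2) K_vec by auto
      have k'K: "k' \<in> K"
        using K_diff[of b k'] bK less.prems k' by simp
      obtain e where "b e \<noteq> 0"
        using bK(2) by (auto simp: fun_eq_iff)
      then have "e \<in> E"
        using bK(3) by (auto simp: vectors_def)
      then have "0 < sum b E"
        using \<open>b e \<noteq> 0\<close> E(1) by (simp add: sum_pos2)
      then have "sum k' E < sum k E"
        by (simp add: k' sum.distrib)
      then have "f (m + k') \<in> orbit (h ` B) (f ` M)"
        using less.hyps k'K by blast
      then have "h b (f (m + k')) \<in> orbit (h ` B) (f ` M)"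
        using b(1) by (rule orbit.orbit_step[OF _ imageI])
      moreover have "h b (f (m + k')) = f (m + k)"
      proof -
        have "m + k' \<in> D"
          using DK[of m k'] k'K M(2) that(1) by auto
        then show ?thesis
          using h[of "m + k'" b] bK(1) k' by (simp add: ac_simps)
      qed
      ultimately show ?thesis
        by simp
    qed
  qed
  have orb: "f ` D = orbit (h ` B) (f ` M)"
  proof
    show "f ` D \<subseteq> orbit (h ` B) (f ` M)"
    proof (rule image_subsetI)
      fix d assume d: "d \<in> D"
      then obtain m k where "m \<in> M" "d = m + k"
        using M(3) le_split by blast
      then show "f d \<in> orbit (h ` B) (f ` M)"
        using gen[of m k] KD[of m k] M(2) d by auto
    qed
    have "h b (f d) \<in> f ` D" if "b \<in> B" "d \<in> D" for b d
      using that h[of d b] DK[of d b] B(2) by auto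
    then show "orbit (h ` B) (f ` M) \<subseteq> f ` D"
      using M(2) by (intro orbit_least) auto
  qed
  have hK: "b \<in> K" "b \<noteq> 0" if "b \<in> B" for b
    using that B(2) by auto
  have wt: "\<exists>w>0. \<forall>x\<in>f ` D. l (h b x) = l x + w" if b: "b \<in> B" for b
  proof (intro exI conjI ballI)
    have D0: "d0 + b \<in> D"
      using hK(1)[OF b] d0 DK by simp
    have lt: "l (f d0) < l (f (d0 + b))"
      using hK[OF b] d0 D0 by (intro flat_map_less[OF f]) (auto simp: le_fun_def fun_eq_iff)
    then show "0 < l (f (d0 + b)) - l (f d0)"
      by simp
    fix x assume "x \<in> f ` D"
    then obtain u where u: "u \<in> D" "x = f u"
      by blast
    have "l (f u) + l (f (d0 + b)) = l (f d0) + l (f (u + b))"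
      using hK[OF b] u DK[of u b] by (intro flat_mapD(2)[OF f _ D0 d0]) (auto simp: algebra_simps)
    then show "l (h b x) = l x + (l (f (d0 + b)) - l (f d0))"
      using h[of u b] u hK[OF b] lt by simp
  qed
  have inj: "inj_on (h b) (f ` D)" if b: "b \<in> B" for b
  proof (rule inj_onI)
    fix x y assume "x \<in> f ` D" "y \<in> f ` D" and eq: "h b x = h b y"
    then obtain u v where uv: "u \<in> D" "x = f u" "v \<in> D" "y = f v"
      by blast
    have cancel: "f u = t (f (u + b)) (f (d0 + b)) (f d0)" if "u \<in> D" for u
      using that hK[OF b] d0 DK[of u b] DK[of d0 b]
      by (intro flat_mapD(1)[OF f]) (simp_all add: ac_simps)
    then show "x = y"
      using eq uv hK[OF b] h by simp
  qed
  have comm: "commute_on (f ` D) (h ` B)"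
  proof -
    have "h b (h c (f u)) = f (u + c + b)" if "b \<in> B" "c \<in> B" "u \<in> D" for b c u
      using that h hK DK by simp
    then show ?thesis
      by (simp add: commute_on_def add.assoc add.commute add.left_commute)
  qed
  have "rational_fps (weight_series l (f ` D))"
    using B(1) M(1) comm inj wt unfolding orb by (intro rational_weight_series_orbit) auto
  moreover have "finite_levels l (f ` D)"
    unfolding orb
  proof (rule finite_levels_orbit)
    fix g x assume "g \<in> h ` B" "x \<in> orbit (h ` B) (f ` M)"
    then show "l x < l (g x)"
      using wt orb by fastforce
  qed (use B(1) M(1) in auto)
  ultimately show ?thesis
    by blast
qed

text \<open>The coordinates are indexed by natural numbers only to have one type for all index sets; by
  \<open>flat_imageI\<close> any finite index set may be used.\<close>

definition flat_image :: "('x \<Rightarrow> 'x \<Rightarrow> 'x \<Rightarrow> 'x) \<Rightarrow> ('x \<Rightarrow> nat) \<Rightarrow> 'x set \<Rightarrow> bool" where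
  "flat_image t l X \<longleftrightarrow>
    (\<exists>(E :: nat set) D f. finite E \<and> D \<subseteq> vectors E \<and> flat D \<and> flat_map t l D f \<and> X = f ` D)"

lemma flat_imageI:
  fixes D :: "('e \<Rightarrow> nat) set"
  assumes "finite E" "D \<subseteq> vectors E" "flat D" "flat_map t l D f"
  shows "flat_image t l (f ` D)"
proof -
  obtain \<eta> :: "'e \<Rightarrow> nat" and N where \<eta>: "inj_on \<eta> E"
    using finite_imp_inj_to_nat_seg[OF assms(1)] by blast
  define \<iota> where "\<iota> u = (\<lambda>e. if e \<in> E then u (\<eta> e) else 0)" for u :: "nat \<Rightarrow> nat"
  define D' where "D' = {u \<in> vectors (\<eta> ` E). \<iota> u \<in> D}"
  have \<iota>_add: "\<iota> (u + v) = \<iota> u + \<iota> v" for u v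
    by (auto simp: \<iota>_def fun_eq_iff)
  have \<iota>_less: "\<iota> u \<le> \<iota> v" "\<iota> u \<noteq> \<iota> v"
    if uv: "u \<in> D'" "v \<in> D'" "u \<le> v" "u \<noteq> v" for u v
  proof -
    show "\<iota> u \<le> \<iota> v"
      using uv(3) by (auto simp: \<iota>_def le_fun_def)
    obtain i where i: "u i \<noteq> v i"
      using uv(4) by blast
    then have "i \<in> \<eta> ` E"
      using uv(1,2) unfolding D'_def vectors_def by (metis (mono_tags, lifting) mem_Collect_eq)
    then obtain e where "e \<in> E" "i = \<eta> e"
      by blast
    then have "\<iota> u e \<noteq> \<iota> v e"
      using i by (simp add: \<iota>_def)
    then show "\<iota> u \<noteq> \<iota> v"
      by auto
  qed
  have "d \<in> \<iota> ` D'" if "d \<in> D" for d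
  proof -
    define u where "u i = (if i \<in> \<eta> ` E then d (the_inv_into E \<eta> i) else 0)" for i
    have "\<iota> u = d"
      using assms(2) that \<eta> by (auto simp: \<iota>_def u_def vectors_def fun_eq_iff the_inv_into_f_f)
    moreover have "u \<in> vectors (\<eta> ` E)"
      by (auto simp: u_def vectors_def)
    ultimately show ?thesis
      using that unfolding D'_def by (intro image_eqI[of _ _ u]) auto
  qed
  then have "f ` D = (f \<circ> \<iota>) ` D'"
    by (force simp: D'_def)
  moreover have "flat D'"
    unfolding flat_def
  proof (intro ballI allI impI)
    fix p q r s assume *: "p \<in> D'" "q \<in> D'" "r \<in> D'" and eq: "p + q = r + s"
    have "\<iota> s \<in> D"
      by (rule flatD[OF assms(3), of "\<iota> p" "\<iota> q" "\<iota> r"])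
         (use * eq in \<open>simp_all add: D'_def flip: \<iota>_add\<close>)
    moreover have "s \<in> vectors (\<eta> ` E)"
      by (rule vectors_summand[of p _ q r]) (use * eq in \<open>auto simp: D'_def\<close>)
    ultimately show "s \<in> D'"
      by (simp add: D'_def)
  qed
  moreover have "flat_map t l D' (f \<circ> \<iota>)"
    unfolding flat_map_def
  proof (intro conjI ballI impI)
    fix p q r s assume D': "p \<in> D'" "q \<in> D'" "r \<in> D'" "s \<in> D'" and eq: "p + q = r + s"
    have "\<iota> p \<in> D" "\<iota> q \<in> D" "\<iota> r \<in> D" "\<iota> s \<in> D" "\<iota> p + \<iota> q = \<iota> r + \<iota> s"
      using D' eq by (simp_all add: D'_def flip: \<iota>_add)
    from flat_mapD[OF assms(4) this]
    show "(f \<circ> \<iota>) s = t ((f \<circ> \<iota>) p) ((f \<circ> \<iota>) r) ((f \<circ> \<iota>) q)"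
      "l ((f \<circ> \<iota>) p) + l ((f \<circ> \<iota>) q) = l ((f \<circ> \<iota>) r) + l ((f \<circ> \<iota>) s)"
      by simp_all
  next
    fix p q assume "p \<in> D'" "q \<in> D'" "p \<le> q" "p \<noteq> q"
    then show "l ((f \<circ> \<iota>) p) < l ((f \<circ> \<iota>) q)"
      using \<iota>_less[of p q] flat_map_less[OF assms(4)] by (simp add: D'_def)
  qed
  moreover have "finite (\<eta> ` E)" "D' \<subseteq> vectors (\<eta> ` E)"
    using assms(1) by (auto simp: D'_def)
  ultimately show ?thesis
    unfolding flat_image_def by metis
qed

text \<open>The fibre product of the two parametrisations is flat because the equation \<open>f u = f' v\<close> is
  preserved by \<open>p + q - r\<close>: both sides are computed by the same operation \<open>t\<close>. A strict increase of a
  pair may happen in the second component alone; then the weight grows along \<open>f'\<close>, which agrees with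
  \<open>f\<close> there.\<close>

lemma flat_image_Int:
  assumes "flat_image t l X" "flat_image t l Y"
  shows "flat_image t l (X \<inter> Y)"
proof -
  obtain E :: "nat set" and D f
    where X: "finite E" "D \<subseteq> vectors E" "flat D" "flat_map t l D f" "X = f ` D"
    using assms(1) unfolding flat_image_def by blast
  obtain E' :: "nat set" and D' f'
    where Y: "finite E'" "D' \<subseteq> vectors E'" "flat D'" "flat_map t l D' f'" "Y = f' ` D'"
    using assms(2) unfolding flat_image_def by blast
  define E2 where "E2 = Inl ` E \<union> Inr ` E'"
  define D2 where "D2 = {u \<in> vectors E2. u \<circ> Inl \<in> D \<and> u \<circ> Inr \<in> D' \<and> f (u \<circ> Inl) = f' (u \<circ> Inr)}"
  define f2 where "f2 u = f (u \<circ> Inl)" for u :: "nat + nat \<Rightarrow> nat"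
  have comp: "(p \<circ> j) + (q \<circ> j) = (r \<circ> j) + (s \<circ> j)" if "p + q = r + s"
    for p q r s :: "nat + nat \<Rightarrow> nat" and j :: "nat \<Rightarrow> nat + nat"
    using that by (auto simp: fun_eq_iff)
  have "X \<inter> Y = f2 ` D2"
  proof
    show "f2 ` D2 \<subseteq> X \<inter> Y"
    proof (rule image_subsetI)
      fix u assume "u \<in> D2"
      then have "f2 u = f (u \<circ> Inl)" "f2 u = f' (u \<circ> Inr)" "u \<circ> Inl \<in> D" "u \<circ> Inr \<in> D'"
        by (simp_all add: D2_def f2_def)
      then show "f2 u \<in> X \<inter> Y"
        using X(5) Y(5) by (metis IntI imageI)
    qed
    show "X \<inter> Y \<subseteq> f2 ` D2"
    proof
      fix x assume "x \<in> X \<inter> Y"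
      then obtain u v where uv: "u \<in> D" "x = f u" "v \<in> D'" "x = f' v"
        using X(5) Y(5) by blast
      let ?w = "case_sum u v"
      have "?w \<circ> Inl = u" "?w \<circ> Inr = v"
        by auto
      moreover have "?w \<in> vectors E2"
        using subsetD[OF X(2) uv(1)] subsetD[OF Y(2) uv(3)]
        by (auto simp: vectors_def E2_def image_iff split: sum.splits)
      ultimately show "x \<in> f2 ` D2"
        using uv by (intro image_eqI[of _ _ ?w]) (auto simp: D2_def f2_def)
    qed
  qed
  moreover have "flat D2"
    unfolding flat_def
  proof (intro ballI allI impI)
    fix p q r s assume *: "p \<in> D2" "q \<in> D2" "r \<in> D2" and eq: "p + q = r + s"
    have s: "s \<circ> Inl \<in> D" "s \<circ> Inr \<in> D'"
      using * flatD[OF X(3) _ _ _ comp[OF eq]] flatD[OF Y(3) _ _ _ comp[OF eq]]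
      by (auto simp: D2_def)
    have "f (s \<circ> Inl) = f' (s \<circ> Inr)"
      using * flat_mapD(1)[OF X(4) _ _ _ s(1) comp[OF eq]] flat_mapD(1)[OF Y(4) _ _ _ s(2) comp[OF eq]]
      by (auto simp: D2_def)
    moreover have "s \<in> vectors E2"
      by (rule vectors_summand[of p _ q r]) (use * eq in \<open>auto simp: D2_def\<close>)
    ultimately show "s \<in> D2"
      using s by (simp add: D2_def)
  qed
  moreover have "flat_map t l D2 f2"
    unfolding flat_map_def
  proof (intro conjI ballI impI)
    fix p q r s assume *: "p \<in> D2" "q \<in> D2" "r \<in> D2" "s \<in> D2" and eq: "p + q = r + s"
    show "f2 s = t (f2 p) (f2 r) (f2 q)" "l (f2 p) + l (f2 q) = l (f2 r) + l (f2 s)"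
    proof -
      have "p \<circ> Inl \<in> D" "q \<circ> Inl \<in> D" "r \<circ> Inl \<in> D" "s \<circ> Inl \<in> D"
        using * by (simp_all add: D2_def)
      from flat_mapD[OF X(4) this comp[OF eq]]
      show "f2 s = t (f2 p) (f2 r) (f2 q)" "l (f2 p) + l (f2 q) = l (f2 r) + l (f2 s)"
        by (simp_all add: f2_def)
    qed
  next
    fix p q assume *: "p \<in> D2" "q \<in> D2" "p \<le> q" "p \<noteq> q"
    have le: "p \<circ> j \<le> q \<circ> j" for j :: "nat \<Rightarrow> nat + nat"
      using *(3) by (simp add: le_fun_def)
    show "l (f2 p) < l (f2 q)"
    proof (cases "p \<circ> Inl = q \<circ> Inl")
      case False
      then show ?thesis
        using * le[of Inl] flat_map_less[OF X(4), of "p \<circ> Inl" "q \<circ> Inl"]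
        unfolding D2_def f2_def by blast
    next
      case True
      have "p \<circ> Inr \<noteq> q \<circ> Inr"
      proof
        assume "p \<circ> Inr = q \<circ> Inr"
        then have "p e = q e" for e
          using True by (cases e) (metis comp_apply)+
        then show False
          using *(4) by blast
      qed
      then have "l (f' (p \<circ> Inr)) < l (f' (q \<circ> Inr))"
        using * le[of Inr] flat_map_less[OF Y(4), of "p \<circ> Inr" "q \<circ> Inr"]
        unfolding D2_def by blast
      then show ?thesis
        using * by (simp add: D2_def f2_def)
    qed
  qed
  moreover have "finite E2" "D2 \<subseteq> vectors E2"
    using X(1) Y(1) by (auto simp: E2_def D2_def)
  ultimately show ?thesis
    using flat_imageI[of E2 D2 t l f2] by simp
qed

lemma rational_weight_series_UN_flat_image:
  assumes "finite I" "\<And>i. i \<in> I \<Longrightarrow> flat_image t l (X i)"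
  shows "rational_fps (weight_series l (\<Union>i\<in>I. X i)) \<and> finite_levels l (\<Union>i\<in>I. X i)"
proof (rule rational_weight_series_UN[where C = "Collect (flat_image t l)"])
  fix X assume "X \<in> Collect (flat_image t l)"
  then obtain E :: "nat set" and D f
    where "finite E" "D \<subseteq> vectors E" "flat D" "flat_map t l D f" "X = f ` D"
    unfolding flat_image_def by blast
  then show "rational_fps (weight_series l X)" "finite_levels l X"
    using flat_image_series by blast+
qed (use assms flat_image_Int in auto)

section \<open>Walks in finite directed graphs\<close>

fun walk :: "('e \<Rightarrow> 'v) \<Rightarrow> ('e \<Rightarrow> 'v) \<Rightarrow> 'v \<Rightarrow> 'e list \<Rightarrow> 'v \<Rightarrow> bool" where
  "walk src tgt v [] v' \<longleftrightarrow> v = v'"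
| "walk src tgt v (e # es) v' \<longleftrightarrow> src e = v \<and> walk src tgt (tgt e) es v'"

lemma walk_append:
  "walk src tgt v (es @ es') v' \<longleftrightarrow> (\<exists>u. walk src tgt v es u \<and> walk src tgt u es' v')"
  by (induction es arbitrary: v) auto

definition balanced :: "('e \<Rightarrow> 'v) \<Rightarrow> ('e \<Rightarrow> 'v) \<Rightarrow> 'e set \<Rightarrow> ('e \<Rightarrow> nat) \<Rightarrow> bool" where
  "balanced src tgt E c \<longleftrightarrow> (\<forall>v. sum c {e \<in> E. src e = v} = sum c {e \<in> E. tgt e = v})"

lemma count_list_vectors: "set es \<subseteq> E \<Longrightarrow> count_list es \<in> vectors E"
  by (auto simp: vectors_def count_list_0_iff)

lemma sum_count_list_Cons:
  assumes "finite A"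
  shows "sum (count_list (e # es)) A = sum (count_list es) A + (if e \<in> A then 1 else 0)"
proof -
  have "sum (count_list (e # es)) A = (\<Sum>x\<in>A. count_list es x + (if x = e then 1 else 0))"
    by (intro sum.cong) auto
  also have "\<dots> = sum (count_list es) A + (\<Sum>x\<in>A. if x = e then 1 else 0)"
    by (rule sum.distrib)
  finally show ?thesis
    using assms by simp
qed

text \<open>Every visit of a vertex enters and leaves it, except at the two ends of the walk.\<close>

lemma walk_balance:
  assumes "finite E" "walk src tgt v es v'" "set es \<subseteq> E"
  shows "sum (count_list es) {e \<in> E. src e = u} + (if u = v' then 1 else 0)
       = sum (count_list es) {e \<in> E. tgt e = u} + (if u = v then 1 else (0 :: nat))"
  using assms(2,3)
proof (induction es arbitrary: v)
  case (Cons e es)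
  then have "sum (count_list es) {e \<in> E. src e = u} + (if u = v' then 1 else 0)
       = sum (count_list es) {e \<in> E. tgt e = u} + (if u = tgt e then 1 else (0 :: nat))"
    by simp
  then show ?case
    using Cons.prems assms(1)
    by (auto simp: sum_count_list_Cons simp del: count_list.simps split: if_splits)
qed simp

text \<open>A longest walk from the source of \<open>e0\<close> that uses no edge more often than \<open>c\<close> allows must end where it
  started: at any other end vertex it would have used up more of the incoming than of the outgoing
  capacity, and as \<open>c\<close> is balanced an outgoing edge would be left to prolong it.\<close>

lemma closed_walk_in_balanced:
  assumes E: "finite E" and c: "balanced src tgt E c" "c e0 \<noteq> 0" "e0 \<in> E" "c \<in> vectors E"
  obtains z v where "walk src tgt v z v" "z \<noteq> []" "set z \<subseteq> E" "count_list z \<le> c"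
proof -
  define P where "P es \<longleftrightarrow> es \<noteq> [] \<and> set es \<subseteq> E \<and> count_list es \<le> c \<and> (\<exists>v. walk src tgt (src e0) es v)"
    for es
  have "P [e0]"
    using c by (auto simp: P_def le_fun_def)
  moreover have "length es \<le> sum c E" if "P es" for es
  proof -
    have "length es = sum (count_list es) E"
      using that E sum_count_set[of es E] by (auto simp: P_def)
    also have "\<dots> \<le> sum c E"
      using that by (intro sum_mono) (auto simp: P_def le_fun_def)
    finally show ?thesis .
  qed
  ultimately obtain es where es: "P es" and maxl: "\<And>es'. P es' \<Longrightarrow> length es' \<le> length es"
    using ex_has_greatest_nat[of P "[e0]" length "Suc (sum c E)"] less_Suc_eq_le by blast
  then obtain v where v: "walk src tgt (src e0) es v" "es \<noteq> []" "set es \<subseteq> E" "count_list es \<le> c"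
    by (auto simp: P_def)
  have "v = src e0"
  proof (rule ccontr)
    assume neq: "v \<noteq> src e0"
    have "\<exists>e\<in>E. src e = v \<and> count_list es e < c e"
    proof (rule ccontr)
      assume no: "\<not> ?thesis"
      have "sum c {e \<in> E. src e = v} \<le> sum (count_list es) {e \<in> E. src e = v}"
        using no by (intro sum_mono) (auto simp: not_less)
      also have "\<dots> < sum (count_list es) {e \<in> E. tgt e = v}"
        using walk_balance[OF E v(1,3), of v] neq by simp
      also have "\<dots> \<le> sum c {e \<in> E. tgt e = v}"
        using v(4) by (intro sum_mono) (auto simp: le_fun_def)
      finally show False
        using c(1) by (simp add: balanced_def)
    qed
    then obtain e where e: "e \<in> E" "src e = v" "count_list es e < c e"
      by blast
    have "P (es @ [e])"
      using v e by (auto simp: P_def walk_append le_fun_def Suc_le_eq)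
    then show False
      using maxl[of "es @ [e]"] by simp
  qed
  then show ?thesis
    using that v by blast
qed

text \<open>The inductive form of Euler's theorem: split a closed walk off the circulation and insert it into the
  given walk at a place where the latter uses the first edge of the closed walk.\<close>

lemma walk_absorbs_circulation:
  assumes E: "finite E" and w: "walk src tgt v es v'" "set es \<subseteq> E"
    and c: "balanced src tgt E c" "c \<in> vectors (set es)"
  shows "\<exists>es'. walk src tgt v es' v' \<and> set es' = set es \<and> count_list es' = count_list es + c"
  using w c
proof (induction "sum c E" arbitrary: es c rule: less_induct)
  case less
  show ?case
  proof (cases "c = 0")
    case True
    then show ?thesis
      using less.prems by (intro exI[of _ es]) auto
  next
    case False
    then obtain e0 where e0: "c e0 \<noteq> 0"
      by (auto simp: fun_eq_iff)
    have "e0 \<in> E" "c \<in> vectors E"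
      using e0 less.prems by (auto simp: vectors_def)
    then obtain z u where z: "walk src tgt u z u" "z \<noteq> []" "set z \<subseteq> E" "count_list z \<le> c"
      using closed_walk_in_balanced[OF E less.prems(3) e0] by blast
    obtain a z' where az: "z = a # z'"
      using z(2) by (cases z) auto
    have z_es: "set z \<subseteq> set es"
    proof
      fix e assume "e \<in> set z"
      then have "c e \<noteq> 0"
        using z(4) by (metis count_list_0_iff le_fun_def le_zero_eq)
      then show "e \<in> set es"
        using less.prems(4) by (auto simp: vectors_def)
    qed
    then have "a \<in> set es"
      by (simp add: az)
    then obtain es1 es2 where es12: "es = es1 @ a # es2"
      by (meson split_list)
    define es' where "es' = es1 @ z @ a # es2"
    define c' where "c' e = c e - count_list z e" for e
    have c': "c = count_list z + c'"
      using z(4) by (auto simp: c'_def le_fun_def fun_eq_iff)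
    have "walk src tgt v es' v'"
      using less.prems(1) z(1) az by (auto simp: es'_def es12 walk_append)
    moreover have es': "set es' = set es" "count_list es' = count_list es + count_list z"
      using z_es by (auto simp: es'_def es12 fun_eq_iff)
    moreover have "balanced src tgt E c'"
      unfolding balanced_def
    proof
      fix x
      have "sum c {e \<in> E. src e = x} = sum c {e \<in> E. tgt e = x}"
        using less.prems(3) by (simp add: balanced_def)
      then show "sum c' {e \<in> E. src e = x} = sum c' {e \<in> E. tgt e = x}"
        using walk_balance[OF E z(1,3), of x] unfolding c' by (simp add: sum.distrib)
    qed
    moreover have "sum c' E < sum c E"
    proof -
      have "sum (count_list z) E = length z"
        using z(3) E sum_count_set[of z E] by auto
      then show ?thesis
        using z(2) unfolding c' by (simp add: sum.distrib)
    qed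
    moreover have "c' \<in> vectors (set es')"
      using less.prems(4) es' by (auto simp: c'_def vectors_def)
    ultimately show ?thesis
      using less.hyps[of c' es'] less.prems(2) es' c' by (auto simp: add.assoc)
  qed
qed

lemma flat_circulations: "flat {c \<in> vectors F. balanced src tgt E c}"
  unfolding flat_def
proof (intro ballI allI impI CollectI conjI)
  fix p q r s assume *: "p \<in> {c \<in> vectors F. balanced src tgt E c}"
    "q \<in> {c \<in> vectors F. balanced src tgt E c}" "r \<in> {c \<in> vectors F. balanced src tgt E c}"
    and eq: "p + q = r + s"
  show "s \<in> vectors F"
    by (rule vectors_summand[of p _ q r]) (use * eq in auto)
  have "sum p A + sum q A = sum r A + sum s A" for A
    using fun_cong[OF eq] by (simp flip: sum.distrib)
  then show "balanced src tgt E s"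
    using * unfolding balanced_def by (metis (mono_tags, lifting) add_left_cancel mem_Collect_eq)
qed

text \<open>The set \<open>M\<close> contains, by Dickson's lemma, a lower bound for each of the count vectors on the left.
  Walks with the same ends have count vectors with balanced difference; conversely every circulation
  on \<open>F\<close> can be absorbed, because the walk belonging to a member of \<open>M\<close> already uses all edges in \<open>F\<close>.\<close>

lemma walk_counts_decomposition:
  assumes E: "finite E" and F: "F \<subseteq> E"
  shows "\<exists>M. finite M \<and> M \<subseteq> vectors E \<and>
    {count_list es | es. walk src tgt v es v' \<and> set es = F}
      = (\<Union>m\<in>M. (\<lambda>c. m + c) ` {c \<in> vectors F. balanced src tgt E c})"
proof -
  let ?W = "{count_list es | es. walk src tgt v es v' \<and> set es = F}"
  let ?C = "{c \<in> vectors F. balanced src tgt E c}"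
  have W: "?W \<subseteq> vectors E"
    using F by (auto intro: count_list_vectors)
  obtain M where M: "finite M" "M \<subseteq> ?W" "\<And>u. u \<in> ?W \<Longrightarrow> \<exists>m\<in>M. m \<le> u"
    using dickson[OF E W] by blast
  have "?W \<subseteq> (\<Union>m\<in>M. (\<lambda>c. m + c) ` ?C)"
  proof
    fix u assume u: "u \<in> ?W"
    then obtain m where m: "m \<in> M" "m \<le> u"
      using M(3) by blast
    obtain es es' where es: "u = count_list es" "walk src tgt v es v'" "set es = F"
      and es': "m = count_list es'" "walk src tgt v es' v'" "set es' = F"
      using u m(1) M(2) by blast
    define c where "c e = u e - m e" for e
    have c: "u = m + c"
      using m(2) by (auto simp: c_def le_fun_def fun_eq_iff)
    have "balanced src tgt E c"
      unfolding balanced_def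
    proof
      fix x
      have "sum u A = sum m A + sum c A" for A
        by (simp add: c sum.distrib)
      then show "sum c {e \<in> E. src e = x} = sum c {e \<in> E. tgt e = x}"
        using walk_balance[OF E es(2), of x] walk_balance[OF E es'(2), of x] es es' F by simp
    qed
    moreover have "c \<in> vectors F"
      using es by (auto simp: c_def vectors_def)
    ultimately show "u \<in> (\<Union>m\<in>M. (\<lambda>c. m + c) ` ?C)"
      using c m(1) by blast
  qed
  moreover have "m + c \<in> ?W" if m: "m \<in> M" and c: "c \<in> ?C" for m c
  proof -
    obtain es where es: "m = count_list es" "walk src tgt v es v'" "set es = F"
      using m M(2) by blast
    then obtain es' where "walk src tgt v es' v'" "set es' = set es" "count_list es' = count_list es + c"
      using walk_absorbs_circulation[OF E es(2), of c] c F by auto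
    then show ?thesis
      using es by (intro CollectI exI[of _ es']) simp
  qed
  ultimately have "?W = (\<Union>m\<in>M. (\<lambda>c. m + c) ` ?C)"
    by blast
  moreover have "M \<subseteq> vectors E"
    using M(2) W by (rule subset_trans)
  ultimately show ?thesis
    using M(1) by blast
qed

section \<open>Words in a group with an abelian subgroup of finite index\<close>

context group
begin

lemma cancel_left:
  assumes "x \<in> carrier G" "y \<in> carrier G"
  shows "inv x \<otimes> (x \<otimes> y) = y" "x \<otimes> (inv x \<otimes> y) = y"
  using assms by (simp_all flip: m_assoc)

lemma heap_translate:
  assumes "a \<in> carrier G" "b \<in> carrier G" "c \<in> carrier G" "g \<in> carrier G" "h \<in> carrier G"
  shows "(g \<otimes> (a \<otimes> h)) \<otimes> inv (g \<otimes> (b \<otimes> h)) \<otimes> (g \<otimes> (c \<otimes> h)) = g \<otimes> ((a \<otimes> inv b \<otimes> c) \<otimes> h)"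
  using assms by (simp add: inv_mult_group m_assoc cancel_left)

end

text \<open>The map \<open>\<kappa>\<close> labels the elements of the group by finitely many labels, each of which occurs in one right
  coset of \<open>N\<close> only. This form of finite index passes to direct powers coordinatewise. The alphabet \<open>L\<close> is
  separate from the group since distinct letters may have the same value and different weights.\<close>

locale coset_automaton = group G for G (structure) +
  fixes N :: "'a set" and \<kappa> :: "'a \<Rightarrow> 'k" and L :: "'l set" and val :: "'l \<Rightarrow> 'a" and wt :: "'l \<Rightarrow> nat"
  assumes N: "subgroup N G" and N_comm: "\<And>a b. a \<in> N \<Longrightarrow> b \<in> N \<Longrightarrow> a \<otimes> b = b \<otimes> a"
    and \<kappa>_finite: "finite (\<kappa> ` carrier G)"
    and \<kappa>_coset: "\<And>x y. x \<in> carrier G \<Longrightarrow> y \<in> carrier G \<Longrightarrow> \<kappa> x = \<kappa> y \<Longrightarrow> x \<otimes> inv y \<in> N"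
    and L: "finite L" and val: "\<And>s. s \<in> L \<Longrightarrow> val s \<in> carrier G" and wt: "\<And>s. s \<in> L \<Longrightarrow> 0 < wt s"
begin

abbreviation NG where "NG \<equiv> G\<lparr>carrier := N\<rparr>"

lemma N_carrier: "a \<in> N \<Longrightarrow> a \<in> carrier G"
  using N by (rule subgroup.mem_carrier)

lemma comm_group_N: "comm_group NG"
  by (rule group.group_comm_groupI[OF subgroup_imp_group[OF N]]) (simp add: N_comm)

definition rep :: "'a \<Rightarrow> 'a" where
  "rep g = (SOME h. h \<in> carrier G \<and> \<kappa> h = \<kappa> g)"

lemma rep: "g \<in> carrier G \<Longrightarrow> rep g \<in> carrier G" "g \<in> carrier G \<Longrightarrow> \<kappa> (rep g) = \<kappa> g"
  unfolding rep_def by (metis (mono_tags, lifting) someI)+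

definition states :: "'a set" where
  "states = rep ` carrier G"

lemma states_carrier: "q \<in> states \<Longrightarrow> q \<in> carrier G"
  using rep(1) by (auto simp: states_def)

lemma rep_states: "g \<in> carrier G \<Longrightarrow> rep g \<in> states"
  by (auto simp: states_def)

lemma finite_states: "finite states"
proof -
  have "states = (\<lambda>k. SOME h. h \<in> carrier G \<and> \<kappa> h = k) ` \<kappa> ` carrier G"
    by (auto simp: states_def rep_def)
  then show ?thesis
    using \<kappa>_finite by simp
qed

definition edges :: "('a \<times> 'l) set" where
  "edges = states \<times> L"

lemma finite_edges: "finite edges"
  by (simp add: edges_def finite_states L)

definition target :: "'a \<times> 'l \<Rightarrow> 'a" where
  "target e = rep (fst e \<otimes> val (snd e))"

lemma map_snd_edges: "set es \<subseteq> edges \<Longrightarrow> map snd es \<in> lists L"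
  by (induction es) (auto simp: edges_def)

lemma target_states: "e \<in> edges \<Longrightarrow> target e \<in> states"
  using states_carrier val by (auto simp: target_def edges_def intro!: rep_states)

definition schreier :: "'a \<times> 'l \<Rightarrow> 'a" where
  "schreier e = fst e \<otimes> val (snd e) \<otimes> inv (target e)"

lemma schreier_N: "e \<in> edges \<Longrightarrow> schreier e \<in> N"
  using states_carrier val rep
  by (auto simp: schreier_def target_def edges_def intro!: \<kappa>_coset)

definition schreier_prod :: "('a \<times> 'l \<Rightarrow> nat) \<Rightarrow> 'a" where
  "schreier_prod u = finprod NG (\<lambda>e. schreier e [^]\<^bsub>NG\<^esub> u e) edges"

lemma schreier_prod_N: "schreier_prod u \<in> N"
proof -
  interpret A: comm_group NG by (rule comm_group_N)
  have "schreier_prod u \<in> carrier NG"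
    unfolding schreier_prod_def
    by (intro A.finprod_closed Pi_I A.nat_pow_closed) (simp add: schreier_N)
  then show ?thesis
    by simp
qed

lemma schreier_prod_add: "schreier_prod (u + v) = schreier_prod u \<otimes> schreier_prod v"
proof -
  interpret A: comm_group NG by (rule comm_group_N)
  have pow: "schreier e [^]\<^bsub>NG\<^esub> k \<in> carrier NG" if "e \<in> edges" for e and k :: nat
    by (intro A.nat_pow_closed) (simp add: schreier_N that)
  have "schreier_prod (u + v)
      = finprod NG (\<lambda>e. schreier e [^]\<^bsub>NG\<^esub> u e \<otimes>\<^bsub>NG\<^esub> schreier e [^]\<^bsub>NG\<^esub> v e) edges"
    unfolding schreier_prod_def
    by (intro A.finprod_cong' refl Pi_I A.m_closed pow)
       (simp_all add: A.nat_pow_mult[symmetric] schreier_N)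
  also have "\<dots> = schreier_prod u \<otimes>\<^bsub>NG\<^esub> schreier_prod v"
    unfolding schreier_prod_def by (intro A.finprod_multf Pi_I pow)
  finally show ?thesis
    by simp
qed

lemma schreier_prod_zero: "schreier_prod (\<lambda>_. 0) = \<one>"
proof -
  interpret A: comm_group NG by (rule comm_group_N)
  show ?thesis
    using A.finprod_one_eqI[of edges "\<lambda>e. schreier e [^]\<^bsub>NG\<^esub> (0::nat)"]
    by (simp add: schreier_prod_def)
qed

lemma schreier_prod_Cons:
  assumes "e \<in> edges"
  shows "schreier_prod (count_list (e # es)) = schreier e \<otimes> schreier_prod (count_list es)"
proof -
  interpret A: comm_group NG by (rule comm_group_N)
  let ?\<delta> = "\<lambda>x. if e = x then 1 else 0 :: nat"
  have "schreier_prod ?\<delta> = finprod NG (\<lambda>x. if e = x then schreier x else \<one>\<^bsub>NG\<^esub>) edges"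
    unfolding schreier_prod_def
    by (intro A.finprod_cong' refl) (auto simp: schreier_N N_carrier subgroup.one_closed[OF N])
  also have "\<dots> = schreier e"
    by (intro A.finprod_singleton assms finite_edges) (simp add: schreier_N)
  finally have "schreier_prod ?\<delta> = schreier e" .
  moreover have "count_list (e # es) = ?\<delta> + count_list es"
    by (auto simp: fun_eq_iff)
  ultimately show ?thesis
    by (simp add: schreier_prod_add)
qed

lemma word_value_closed: "w \<in> lists L \<Longrightarrow> word_value G (map val w) \<in> carrier G"
  by (induction w) (auto simp: word_value_def val)

text \<open>The product of the letters telescopes into Schreier elements, \<open>q val s = schreier (q, s) q'\<close> with \<open>q'\<close>
  the next vertex. As they lie in the abelian group \<open>N\<close>, their order is irrelevant.\<close>

lemma walk_value:
  assumes "walk fst target q es q'" "set es \<subseteq> edges" "q \<in> states"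
  shows "q \<otimes> word_value G (map (\<lambda>e. val (snd e)) es) = schreier_prod (count_list es) \<otimes> q' \<and> q' \<in> states"
  using assms
proof (induction es arbitrary: q)
  case Nil
  then show ?case
    using states_carrier[of q] by (simp add: schreier_prod_zero word_value_def)
next
  case (Cons e es)
  let ?w = "word_value G (map (\<lambda>e. val (snd e)) es)"
  have e: "e \<in> edges" "fst e = q" "walk fst target (target e) es q'"
    using Cons.prems by auto
  have IH: "target e \<otimes> ?w = schreier_prod (count_list es) \<otimes> q'" "q' \<in> states"
    using Cons.IH[OF e(3)] Cons.prems(2) target_states[OF e(1)] by auto
  have "map snd es \<in> lists L"
    using Cons.prems(2) by (simp add: map_snd_edges)
  then have w: "?w \<in> carrier G"
    using word_value_closed[of "map snd es"] by (simp add: comp_def)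
  have c: "q \<in> carrier G" "val (snd e) \<in> carrier G" "target e \<in> carrier G" "q' \<in> carrier G"
    "schreier e \<in> carrier G" "schreier_prod (count_list es) \<in> carrier G"
    using Cons.prems e IH states_carrier target_states val schreier_N schreier_prod_N N_carrier
    by (auto simp: edges_def)
  have "q \<otimes> word_value G (map (\<lambda>e. val (snd e)) (e # es)) = (q \<otimes> val (snd e)) \<otimes> ?w"
    using c w by (simp add: word_value_def m_assoc)
  also have "q \<otimes> val (snd e) = schreier e \<otimes> target e"
    using c e(2) by (simp add: schreier_def m_assoc)
  also have "schreier e \<otimes> target e \<otimes> ?w = schreier e \<otimes> (schreier_prod (count_list es) \<otimes> q')"
    using c w IH by (simp add: m_assoc)
  also have "\<dots> = schreier_prod (count_list (e # es)) \<otimes> q'"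
    using c by (simp add: schreier_prod_Cons[OF e(1)] m_assoc)
  finally show ?case
    using IH by blast
qed

lemma walk_of_word:
  "w \<in> lists L \<Longrightarrow> q \<in> states \<Longrightarrow>
    \<exists>es q'. walk fst target q es q' \<and> set es \<subseteq> edges \<and> map snd es = w"
proof (induction w arbitrary: q)
  case Nil
  then show ?case
    by (intro exI[of _ "[]"] exI[of _ q]) simp
next
  case (Cons s w)
  have e: "(q, s) \<in> edges"
    using Cons.prems by (auto simp: edges_def)
  then obtain es q' where "walk fst target (target (q, s)) es q'" "set es \<subseteq> edges" "map snd es = w"
    using Cons.IH[of "target (q, s)"] Cons.prems target_states by auto
  then show ?case
    using e by (intro exI[of _ "(q, s) # es"] exI[of _ q']) simp
qed

definition edge_weight :: "('a \<times> 'l \<Rightarrow> nat) \<Rightarrow> nat" where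
  "edge_weight u = (\<Sum>e\<in>edges. u e * wt (snd e))"

lemma edge_weight_add: "edge_weight (u + v) = edge_weight u + edge_weight v"
  by (simp add: edge_weight_def sum.distrib algebra_simps)

lemma edge_weight_count:
  "set es \<subseteq> edges \<Longrightarrow> edge_weight (count_list es) = (\<Sum>e\<leftarrow>es. wt (snd e))"
  using sum_list_map_eq_sum_count2[of es edges "\<lambda>e. wt (snd e)"] finite_edges
  by (simp add: edge_weight_def)

lemma edge_weight_less:
  assumes "u \<in> vectors edges" "v \<in> vectors edges" "u \<le> v" "u \<noteq> v"
  shows "edge_weight u < edge_weight v"
  unfolding edge_weight_def
proof (rule sum_strict_mono_ex1[OF finite_edges])
  show "\<forall>e\<in>edges. u e * wt (snd e) \<le> v e * wt (snd e)"
    using assms(3) by (auto simp: le_fun_def)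
  obtain e where e: "u e \<noteq> v e"
    using assms(4) by (meson ext)
  then have "e \<in> edges"
    using assms(1,2) unfolding vectors_def by (metis (mono_tags, lifting) mem_Collect_eq)
  moreover have "u e < v e"
    using le_funD[OF assms(3), of e] e by simp
  ultimately show "\<exists>e\<in>edges. u e * wt (snd e) < v e * wt (snd e)"
    using wt by (intro bexI[of _ e]) (auto simp: edges_def)
qed

definition start :: 'a where
  "start = rep \<one>"

lemma start: "start \<in> states" "start \<in> N" "start \<in> carrier G"
proof -
  show "start \<in> states" "start \<in> carrier G"
    using rep(1) by (auto simp: start_def intro: rep_states)
  then show "start \<in> N"
    using \<kappa>_coset[of start \<one>] rep(2)[of \<one>] by (simp add: start_def)
qed

text \<open>The value of a walk from \<open>start\<close> to \<open>q\<close> with count vector \<open>u\<close>, extended to all vectors. The vertex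
  \<open>start\<close> represents the trivial coset but need not be the neutral element itself, hence the factor in
  front.\<close>

definition endpoint :: "'a \<Rightarrow> ('a \<times> 'l \<Rightarrow> nat) \<Rightarrow> 'a" where
  "endpoint q u = inv start \<otimes> (schreier_prod u \<otimes> q)"

lemma endpoint_count:
  assumes "walk fst target start es q" "set es \<subseteq> edges"
  shows "endpoint q (count_list es) = word_value G (map (\<lambda>e. val (snd e)) es) \<and> q \<in> states"
proof -
  have v: "start \<otimes> word_value G (map (\<lambda>e. val (snd e)) es) = schreier_prod (count_list es) \<otimes> q"
    "q \<in> states"
    using walk_value[OF assms start(1)] by auto
  have "map snd es \<in> lists L"
    using assms(2) by (simp add: map_snd_edges)
  then have "word_value G (map (\<lambda>e. val (snd e)) es) \<in> carrier G"
    using word_value_closed[of "map snd es"] by (simp add: comp_def)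
  then have "inv start \<otimes> (start \<otimes> word_value G (map (\<lambda>e. val (snd e)) es))
      = word_value G (map (\<lambda>e. val (snd e)) es)"
    using start by (simp flip: m_assoc)
  then show ?thesis
    using v by (simp add: endpoint_def)
qed

lemma endpoint_heap:
  assumes q: "q \<in> states" and eq: "u1 + u2 = u3 + u4"
  shows "endpoint q u4 = endpoint q u1 \<otimes> inv (endpoint q u3) \<otimes> endpoint q u2"
proof -
  let ?P = schreier_prod
  have P: "?P u \<in> carrier G" for u
    by (intro N_carrier schreier_prod_N)
  have "?P u3 \<otimes> ?P u4 = ?P u1 \<otimes> ?P u2"
    using eq by (metis schreier_prod_add)
  then have "?P u4 = inv (?P u3) \<otimes> (?P u1 \<otimes> ?P u2)"
    using P by (simp add: inv_solve_left)
  also have "\<dots> = (inv (?P u3) \<otimes> ?P u1) \<otimes> ?P u2"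
    using P by (simp add: m_assoc)
  also have "inv (?P u3) \<otimes> ?P u1 = ?P u1 \<otimes> inv (?P u3)"
    by (intro N_comm subgroup.m_inv_closed[OF N] schreier_prod_N)
  finally have "endpoint q u4 = inv start \<otimes> ((?P u1 \<otimes> inv (?P u3) \<otimes> ?P u2) \<otimes> q)"
    by (simp only: endpoint_def)
  also have "\<dots> = endpoint q u1 \<otimes> inv (endpoint q u3) \<otimes> endpoint q u2"
    unfolding endpoint_def using q start P by (intro heap_translate[symmetric]) (simp_all add: states_carrier)
  finally show ?thesis .
qed

lemma endpoint_same_coset:
  assumes q: "q \<in> states"
  shows "endpoint q u \<otimes> inv (endpoint q v) \<in> N"
proof -
  let ?P = schreier_prod
  have P: "?P w \<in> carrier G" for w
    by (intro N_carrier schreier_prod_N)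
  have qc: "q \<in> carrier G"
    using q by (rule states_carrier)
  have "q \<otimes> (inv q \<otimes> y) = y" if "y \<in> carrier G" for y
    using qc that by (simp flip: m_assoc)
  then have "endpoint q u \<otimes> inv (endpoint q v) = inv start \<otimes> ?P u \<otimes> inv (?P v) \<otimes> start"
    using P qc start by (simp add: endpoint_def inv_mult_group m_assoc)
  also have "\<dots> \<in> N"
    using start schreier_prod_N N by (intro subgroup.m_closed[OF N] subgroup.m_inv_closed[OF N])
  finally show ?thesis .
qed

text \<open>The pairs of value and weight that words attain are sorted by the end vertex \<open>q\<close> and the set \<open>F\<close> of
  edges of the walk and by one of the finitely many count vectors \<open>m\<close> of \<open>walk_counts_decomposition\<close>. In each class the parameters are the circulations \<open>c\<close>
  on \<open>F\<close>, and those with value in \<open>V\<close> form the flat set \<open>D F q m\<close>, because all values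
  with the same \<open>q\<close> lie in one coset of \<open>N\<close>.\<close>

theorem rational_word_weights:
  assumes V_heap: "\<And>a b c. a \<in> V \<Longrightarrow> b \<in> V \<Longrightarrow> c \<in> V \<Longrightarrow> a \<otimes> inv b \<in> N \<Longrightarrow> c \<otimes> inv b \<in> N \<Longrightarrow>
      a \<otimes> inv b \<otimes> c \<in> V"
  defines "A \<equiv> \<lambda>m. {x \<in> V. \<exists>w\<in>lists L. word_value G (map val w) = x \<and> (\<Sum>s\<leftarrow>w. wt s) = m}"
  shows "rational_fps (Abs_fps (\<lambda>m. of_nat (card (A m))) :: rat fps) \<and> (\<forall>m. finite (A m))"
proof -
  define t :: "'a \<times> nat \<Rightarrow> 'a \<times> nat \<Rightarrow> 'a \<times> nat \<Rightarrow> 'a \<times> nat"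
    where "t x y z = (fst x \<otimes> inv (fst y) \<otimes> fst z, snd x + snd z - snd y)" for x y z
  define f where "f q m c = (endpoint q (m + c), edge_weight (m + c))" for q m c
  define D where "D F q m = {c \<in> vectors F. balanced fst target edges c \<and> endpoint q (m + c) \<in> V}"
    for F q m
  define M where "M F q = (SOME M. finite M \<and> M \<subseteq> vectors edges \<and>
      {count_list es | es. walk fst target start es q \<and> set es = F}
        = (\<Union>m\<in>M. (\<lambda>c. m + c) ` {c \<in> vectors F. balanced fst target edges c}))" for F q
  have M: "finite (M F q) \<and> M F q \<subseteq> vectors edges \<and>
      {count_list es | es. walk fst target start es q \<and> set es = F}
        = (\<Union>m\<in>M F q. (\<lambda>c. m + c) ` {c \<in> vectors F. balanced fst target edges c})"
    if "F \<subseteq> edges" for F q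
    unfolding M_def by (rule someI_ex) (rule walk_counts_decomposition[OF finite_edges that])
  have M_walk: "{count_list es | es. walk fst target start es q \<and> set es = F}
        = (\<Union>m\<in>M F q. (\<lambda>c. m + c) ` {c \<in> vectors F. balanced fst target edges c})"
    if "F \<subseteq> edges" for F q
    using M[OF that, of q] by (elim conjE)
  define I where "I = (SIGMA F:Pow edges. SIGMA q:states. M F q)"
  define X where "X = (\<Union>(F, q, m)\<in>I. f q m ` D F q m)"
  have I: "finite I"
    unfolding I_def using M finite_edges finite_states by (intro finite_SigmaI) auto
  have image: "flat_image t snd (f q m ` D F q m)" if "F \<subseteq> edges" "q \<in> states" "m \<in> M F q" for F q m
  proof (rule flat_imageI)
    have vec: "m + c \<in> vectors edges" if "c \<in> D F q m" for c
      using that M[OF \<open>F \<subseteq> edges\<close>, of q] \<open>m \<in> M F q\<close> \<open>F \<subseteq> edges\<close>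
      by (auto simp: D_def vectors_def subset_iff)
    have shift: "(m + p) + (m + q) = (m + r) + (m + s)" if "p + q = r + s"
      for p q r s :: "'a \<times> 'l \<Rightarrow> nat"
      using that by (metis (no_types, lifting) add.assoc add.left_commute)
    show "finite F"
      using that(1) finite_edges finite_subset by blast
    show "D F q m \<subseteq> vectors F"
      by (auto simp: D_def)
    show "flat (D F q m)"
      unfolding flat_def
    proof (intro ballI allI impI)
      fix p1 p2 p3 p4 assume *: "p1 \<in> D F q m" "p2 \<in> D F q m" "p3 \<in> D F q m" and eq: "p1 + p2 = p3 + p4"
      have "p4 \<in> {c \<in> vectors F. balanced fst target edges c}"
        by (rule flatD[OF flat_circulations _ _ _ eq]) (use * in \<open>auto simp: D_def\<close>)
      moreover have "endpoint q (m + p4) \<in> V"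
        unfolding endpoint_heap[OF that(2) shift[OF eq]]
        by (rule V_heap) (use * that(2) in \<open>auto simp: D_def endpoint_same_coset\<close>)
      ultimately show "p4 \<in> D F q m"
        by (simp add: D_def)
    qed
    show "flat_map t snd (D F q m) (f q m)"
      unfolding flat_map_def
    proof (intro conjI ballI impI)
      fix p1 p2 p3 p4 :: "'a \<times> 'l \<Rightarrow> nat" assume eq: "p1 + p2 = p3 + p4"
      have w: "edge_weight (m + p1) + edge_weight (m + p2) = edge_weight (m + p3) + edge_weight (m + p4)"
        using shift[OF eq] by (metis edge_weight_add)
      then show "snd (f q m p1) + snd (f q m p2) = snd (f q m p3) + snd (f q m p4)"
        by (simp add: f_def)
      show "f q m p4 = t (f q m p1) (f q m p3) (f q m p2)"
        using endpoint_heap[OF that(2) shift[OF eq]] w by (simp add: f_def t_def)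
    next
      fix p1 p2 assume "p1 \<in> D F q m" "p2 \<in> D F q m" "p1 \<le> p2" "p1 \<noteq> p2"
      then show "snd (f q m p1) < snd (f q m p2)"
        using vec edge_weight_less[of "m + p1" "m + p2"] by (simp add: f_def le_fun_def)
    qed
  qed
  have X: "rational_fps (weight_series snd X) \<and> finite_levels snd X"
    unfolding X_def by (rule rational_weight_series_UN_flat_image[OF I]) (use image in \<open>auto simp: I_def\<close>)
  have X_iff: "(x, k) \<in> X \<longleftrightarrow> x \<in> A k" for x k
  proof
    assume "(x, k) \<in> X"
    then obtain F q m c where *: "F \<subseteq> edges" "q \<in> states" "m \<in> M F q" "c \<in> D F q m" "(x, k) = f q m c"
      by (auto simp: X_def I_def)
    then have "m + c \<in> {count_list es | es. walk fst target start es q \<and> set es = F}"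
      unfolding M_walk[OF *(1)] by (auto simp: D_def)
    then obtain es where es: "m + c = count_list es" "walk fst target start es q" "set es = F"
      by blast
    have "x = word_value G (map val (map snd es))" "x \<in> V"
      using * es endpoint_count[OF es(2)] by (auto simp: f_def D_def comp_def)
    moreover have "k = (\<Sum>s\<leftarrow>map snd es. wt s)"
      using * es edge_weight_count[of es] by (simp add: f_def comp_def)
    moreover have "map snd es \<in> lists L"
      using * es by (simp add: map_snd_edges)
    ultimately show "x \<in> A k"
      unfolding A_def by blast
  next
    assume "x \<in> A k"
    then obtain w where w: "x \<in> V" "w \<in> lists L" "word_value G (map val w) = x" "(\<Sum>s\<leftarrow>w. wt s) = k"
      unfolding A_def by blast
    obtain es q where es: "walk fst target start es q" "set es \<subseteq> edges" "map snd es = w"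
      using walk_of_word[OF w(2) start(1)] by blast
    have q: "q \<in> states" "endpoint q (count_list es) = x"
      using endpoint_count[OF es(1,2)] es(3) w(3) by (auto simp: comp_def)
    have k: "edge_weight (count_list es) = k"
      using edge_weight_count[OF es(2)] es(3) w(4) by (auto simp: comp_def)
    have "count_list es \<in> {count_list es' | es'. walk fst target start es' q \<and> set es' = set es}"
      using es by blast
    then obtain m c where mc: "m \<in> M (set es) q" "count_list es = m + c" "c \<in> vectors (set es)"
      "balanced fst target edges c"
      unfolding M_walk[OF es(2)] by auto
    then have "c \<in> D (set es) q m" "f q m c = (x, k)"
      using q k w(1) by (auto simp: D_def f_def)
    moreover have "(set es, q, m) \<in> I"
      using es(2) q(1) mc(1) by (simp add: I_def)
    ultimately show "(x, k) \<in> X"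
      unfolding X_def by force
  qed
  have A: "{y \<in> X. snd y = m} = (\<lambda>x. (x, m)) ` A m" for m
    using X_iff by auto
  have "card {y \<in> X. snd y = m} = card (A m)" for m
    unfolding A by (intro card_image) (simp add: inj_on_def)
  moreover have "finite (A m)" for m
  proof -
    have "finite ((\<lambda>x. (x, m)) ` A m)"
      using X unfolding finite_levels_def A by blast
    then show ?thesis
      by (rule finite_imageD) (simp add: inj_on_def)
  qed
  ultimately show ?thesis
    using X by (simp add: weight_series_def)
qed

end

section \<open>Algebraic sets of virtually abelian groups\<close>

context group
begin

text \<open>\<open>N\<close> is the kernel of the action of the group on the right cosets of \<open>H\<close> by multiplication, and the
  label \<open>\<kappa> x\<close> is the permutation by which \<open>x\<close> acts, of which there are only finitely many.
  The kernel fixes the coset \<open>H\<close>, so it is contained in \<open>H\<close> and abelian.\<close>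

lemma finite_index_abelian_normal:
  assumes H: "subgroup H G" and comm: "comm_group (G\<lparr>carrier := H\<rparr>)" and fin: "finite (rcosets H)"
  obtains N and \<kappa> :: "'a \<Rightarrow> 'a set \<Rightarrow> 'a set"
  where "N \<lhd> G" "\<And>a b. a \<in> N \<Longrightarrow> b \<in> N \<Longrightarrow> a \<otimes> b = b \<otimes> a" "finite (\<kappa> ` carrier G)"
    "\<And>x y. x \<in> carrier G \<Longrightarrow> y \<in> carrier G \<Longrightarrow> \<kappa> x = \<kappa> y \<Longrightarrow> x \<otimes> inv y \<in> N"
proof -
  have HG: "H \<subseteq> carrier G"
    using H by (rule subgroup.subset)
  have sub: "C \<subseteq> carrier G" if "C \<in> rcosets H" for C
    using that HG by (auto simp: RCOSETS_def r_coset_def)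
  have act: "C #> g \<in> rcosets H" if "C \<in> rcosets H" "g \<in> carrier G" for C g
    using that HG by (auto simp: RCOSETS_def coset_mult_assoc)
  define N where "N = {z \<in> carrier G. \<forall>C\<in>rcosets H. C #> z = C}"
  define \<kappa> where "\<kappa> x = (\<lambda>C\<in>rcosets H. C #> x)" for x
  have inv_fix: "C #> inv z = C" if "C \<in> rcosets H" "z \<in> carrier G" "C #> z = C" for C z
    using that sub[OF that(1)] coset_mult_assoc[of C z "inv z"] by simp
  have N: "subgroup N G"
  proof (rule subgroupI)
    show "N \<subseteq> carrier G"
      by (auto simp: N_def)
    show "N \<noteq> {}"
      using sub by (auto simp: N_def intro!: exI[of _ \<one>])
    show "inv a \<in> N" if "a \<in> N" for a
      using that inv_fix by (auto simp: N_def)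
    show "a \<otimes> b \<in> N" if "a \<in> N" "b \<in> N" for a b
      using that sub by (auto simp: N_def coset_mult_assoc[symmetric])
  qed
  have NH: "N \<subseteq> H"
  proof
    fix z assume z: "z \<in> N"
    have "H \<in> rcosets H"
      using rcosetsI[OF HG one_closed] HG by simp
    then have "H #> z = H"
      using z by (simp add: N_def)
    then show "z \<in> H"
      by (rule coset_join1) (use z H in \<open>simp_all add: N_def\<close>)
  qed
  show ?thesis
  proof (rule that)
    show "N \<lhd> G"
    proof (rule normal_invI[OF N])
      fix x h assume x: "x \<in> carrier G" and h: "h \<in> N"
      have "C #> (x \<otimes> h \<otimes> inv x) = C" if C: "C \<in> rcosets H" for C
      proof -
        have "C #> (x \<otimes> h \<otimes> inv x) = ((C #> x) #> h) #> inv x"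
          using x h sub[OF C] sub[OF act[OF C x]] by (simp add: coset_mult_assoc N_def)
        also have "(C #> x) #> h = C #> x"
          using h act[OF C x] by (simp add: N_def)
        also have "(C #> x) #> inv x = C"
          using x sub[OF C] by (simp add: coset_mult_assoc)
        finally show ?thesis .
      qed
      then show "x \<otimes> h \<otimes> inv x \<in> N"
        using x h by (simp add: N_def)
    qed
    show "a \<otimes> b = b \<otimes> a" if "a \<in> N" "b \<in> N" for a b
      using comm_monoid.m_comm[OF comm_group.axioms(1)[OF comm], of a b] that NH by auto
    have "\<kappa> ` carrier G \<subseteq> rcosets H \<rightarrow>\<^sub>E rcosets H"
      using act by (auto simp: \<kappa>_def)
    then show "finite (\<kappa> ` carrier G)"
      by (rule finite_subset) (intro finite_PiE fin)
    show "x \<otimes> inv y \<in> N" if xy: "x \<in> carrier G" "y \<in> carrier G" "\<kappa> x = \<kappa> y" for x y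
    proof -
      have "C #> (x \<otimes> inv y) = C" if C: "C \<in> rcosets H" for C
      proof -
        have "C #> x = C #> y"
          using fun_cong[OF xy(3), of C] C by (simp add: \<kappa>_def)
        then have "C #> (x \<otimes> inv y) = (C #> y) #> inv y"
          using xy sub[OF C] by (simp flip: coset_mult_assoc)
        then show ?thesis
          using xy sub[OF C] by (simp add: coset_mult_assoc)
      qed
      then show ?thesis
        using xy by (simp add: N_def)
    qed
  qed
qed

text \<open>The ternary operation \<open>d = a b\<inverse> c\<close> on a coset of \<open>N\<close>, as a relation, so that its
  compatibility with products and inverses reads like that of a congruence.\<close>

definition heap :: "'a set \<Rightarrow> 'a \<Rightarrow> 'a \<Rightarrow> 'a \<Rightarrow> 'a \<Rightarrow> bool" where
  "heap N a b c d \<longleftrightarrow> a \<in> carrier G \<and> b \<in> carrier G \<and> c \<in> carrier G \<and>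
     a \<otimes> inv b \<in> N \<and> c \<otimes> inv b \<in> N \<and> d = a \<otimes> inv b \<otimes> c"

lemma heap_const: "subgroup N G \<Longrightarrow> a \<in> carrier G \<Longrightarrow> heap N a a a a"
  by (simp add: heap_def subgroup.one_closed)

text \<open>Both \<open>b\<inverse> c\<close> and \<open>a' b'\<inverse>\<close> lie in \<open>N\<close>, the former by normality. They commute, which is what turns
  \<open>(a b\<inverse> c) (a' b'\<inverse> c')\<close> into \<open>(a a') (b b')\<inverse> (c c')\<close>.\<close>

lemma heap_mult:
  assumes N: "N \<lhd> G" and comm: "\<And>a b. a \<in> N \<Longrightarrow> b \<in> N \<Longrightarrow> a \<otimes> b = b \<otimes> a"
    and h: "heap N a b c d" "heap N a' b' c' d'"
  shows "heap N (a \<otimes> a') (b \<otimes> b') (c \<otimes> c') (d \<otimes> d')"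
proof -
  have c: "a \<in> carrier G" "b \<in> carrier G" "c \<in> carrier G" "a' \<in> carrier G" "b' \<in> carrier G" "c' \<in> carrier G"
    using h by (auto simp: heap_def)
  have n: "a \<otimes> inv b \<in> N" "c \<otimes> inv b \<in> N" "a' \<otimes> inv b' \<in> N" "c' \<otimes> inv b' \<in> N"
    using h by (auto simp: heap_def)
  have prod: "(x \<otimes> x') \<otimes> inv (b \<otimes> b') \<in> N"
    if "x \<in> carrier G" "x' \<in> carrier G" "x \<otimes> inv b \<in> N" "x' \<otimes> inv b' \<in> N" for x x'
  proof -
    have "(x \<otimes> x') \<otimes> inv (b \<otimes> b') = (x \<otimes> (x' \<otimes> inv b') \<otimes> inv x) \<otimes> (x \<otimes> inv b)"
      using that c by (simp add: inv_mult_group m_assoc cancel_left)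
    then show ?thesis
      using that normal.inv_op_closed2[OF N] subgroup.m_closed[OF normal_imp_subgroup[OF N]] by simp
  qed
  have "inv b \<otimes> c = inv b \<otimes> (c \<otimes> inv b) \<otimes> b"
    using c by (simp add: m_assoc)
  then have m: "inv b \<otimes> c \<in> N"
    using normal.inv_op_closed1[OF N c(2) n(2)] by simp
  have "d \<otimes> d' = a \<otimes> ((inv b \<otimes> c) \<otimes> (a' \<otimes> inv b')) \<otimes> c'"
    using h c by (simp add: heap_def m_assoc)
  also have "\<dots> = a \<otimes> ((a' \<otimes> inv b') \<otimes> (inv b \<otimes> c)) \<otimes> c'"
    using comm[OF m n(3)] by simp
  also have "\<dots> = (a \<otimes> a') \<otimes> inv (b \<otimes> b') \<otimes> (c \<otimes> c')"
    using c by (simp add: inv_mult_group m_assoc)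
  finally show ?thesis
    using c prod n by (simp add: heap_def)
qed

text \<open>On a coset of an abelian normal subgroup \<open>a b\<inverse> c = c b\<inverse> a\<close>, and the inverse of the latter is
  \<open>a\<inverse> b c\<inverse>\<close>.\<close>

lemma heap_inv:
  assumes N: "N \<lhd> G" and comm: "\<And>a b. a \<in> N \<Longrightarrow> b \<in> N \<Longrightarrow> a \<otimes> b = b \<otimes> a"
    and h: "heap N a b c d"
  shows "heap N (inv a) (inv b) (inv c) (inv d)"
proof -
  have c: "a \<in> carrier G" "b \<in> carrier G" "c \<in> carrier G"
    using h by (auto simp: heap_def)
  have n: "a \<otimes> inv b \<in> N" "c \<otimes> inv b \<in> N"
    using h by (auto simp: heap_def)
  have left: "inv x \<otimes> b \<in> N" if "x \<in> carrier G" "x \<otimes> inv b \<in> N" for x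
  proof -
    have "inv (x \<otimes> inv b) \<in> N"
      using that(2) by (rule subgroup.m_inv_closed[OF normal_imp_subgroup[OF N]])
    then have "inv x \<otimes> inv (x \<otimes> inv b) \<otimes> x \<in> N"
      by (rule normal.inv_op_closed1[OF N that(1)])
    then show ?thesis
      using that(1) c by (simp add: inv_mult_group m_assoc)
  qed
  have "d = (a \<otimes> inv b) \<otimes> (c \<otimes> inv b) \<otimes> b"
    using h c by (simp add: heap_def m_assoc)
  also have "\<dots> = (c \<otimes> inv b) \<otimes> (a \<otimes> inv b) \<otimes> b"
    using comm[OF n] by simp
  also have "\<dots> = c \<otimes> inv b \<otimes> a"
    using c by (simp add: m_assoc)
  finally have "inv d = inv a \<otimes> b \<otimes> inv c"
    using c by (simp add: inv_mult_group m_assoc)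
  then show ?thesis
    using c left n by (simp add: heap_def)
qed

lemma heap_eval_word:
  assumes N: "N \<lhd> G" and comm: "\<And>a b. a \<in> N \<Longrightarrow> b \<in> N \<Longrightarrow> a \<otimes> b = b \<otimes> a"
    and xs: "\<And>i. i \<in> {1..n} \<Longrightarrow> heap N (x i) (y i) (z i) (u i)" and w: "w \<in> fp_words G n"
  shows "heap N (eval_word G (\<lambda>g. g) x w) (eval_word G (\<lambda>g. g) y w)
    (eval_word G (\<lambda>g. g) z w) (eval_word G (\<lambda>g. g) u w)"
  using w
proof (induction w)
  case Nil
  then show ?case
    using heap_const[OF normal_imp_subgroup[OF N]] by (simp add: eval_word_def word_value_def)
next
  case (Cons l w)
  let ?v = "\<lambda>x. letter_value G (\<lambda>g. g) x l"
  have "heap N (?v x) (?v y) (?v z) (?v u)"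
  proof (cases l)
    case (Coef g)
    then show ?thesis
      using Cons.prems heap_const[OF normal_imp_subgroup[OF N]] by simp
  next
    case (Var i)
    then show ?thesis
      using Cons.prems xs by simp
  next
    case (VarInv i)
    then show ?thesis
      using Cons.prems heap_inv[OF N comm xs] by simp
  qed
  moreover have "w \<in> fp_words G n"
    using Cons.prems by (cases l) auto
  ultimately show ?case
    using heap_mult[OF N comm _ Cons.IH] by (simp add: eval_word_def word_value_def)
qed

text \<open>Each equation evaluates to \<open>1\<close> at \<open>x\<close>, \<open>y\<close> and \<open>z\<close>, hence to \<open>1 1\<inverse> 1 = 1\<close> at \<open>u\<close>.\<close>

lemma algebraic_set_heap:
  assumes N: "N \<lhd> G" and comm: "\<And>a b. a \<in> N \<Longrightarrow> b \<in> N \<Longrightarrow> a \<otimes> b = b \<otimes> a"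
    and V: "algebraic_set G n V" and V_in: "x \<in> V" "y \<in> V" "z \<in> V"
    and u: "u \<in> {1..n} \<rightarrow>\<^sub>E carrier G"
    and heap: "\<And>i. i \<in> {1..n} \<Longrightarrow> heap N (x i) (y i) (z i) (u i)"
  shows "u \<in> V"
proof -
  obtain W where W: "W \<subseteq> carrier (free_prod G n)" "V = solution_set G n W"
    using V unfolding algebraic_set_def by blast
  have "subst_hom G n u A = \<one>" if "A \<in> W" for A
  proof -
    obtain w where w: "w \<in> fp_words G n" "A = fp_class G n w"
      using W(1) \<open>A \<in> W\<close> unfolding carrier_free_prod by blast
    have val: "eval_word G (\<lambda>g. g) v w = \<one>" if "v \<in> V" for v
    proof -
      have "v \<in> {1..n} \<rightarrow> carrier G" "subst_hom G n v A = \<one>"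
        using that \<open>A \<in> W\<close> W(2) by (auto simp: solution_set_def)
      then show ?thesis
        using subst_hom_class w by simp
    qed
    have "u \<in> {1..n} \<rightarrow> carrier G"
      using u by auto
    then have "subst_hom G n u A = eval_word G (\<lambda>g. g) u w"
      using subst_hom_class w by simp
    also have "\<dots> = \<one>"
      using heap_eval_word[OF N comm heap w(1)] val V_in by (simp add: heap_def)
    finally show ?thesis .
  qed
  then show ?thesis
    using u W(2) by (simp add: solution_set_def)
qed

end

section \<open>Tuples as elements of a direct power\<close>

text \<open>The letter \<open>Some (i, s)\<close> stands for \<open>s\<close> in coordinate \<open>i\<close>; \<open>None\<close> is the padding letter, of value \<open>1\<close>
  and weight \<open>1\<close>. Padding turns words of weight at most \<open>m\<close> into words of weight exactly \<open>m\<close>.\<close>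

definition tuple_letters :: "nat \<Rightarrow> 'a set \<Rightarrow> (nat \<times> 'a) option set" where
  "tuple_letters n S = insert None (Some ` ({1..n} \<times> S))"

fun tuple_letter :: "('a, 'b) monoid_scheme \<Rightarrow> nat \<Rightarrow> (nat \<times> 'a) option \<Rightarrow> nat \<Rightarrow> 'a" where
  "tuple_letter G n None = (\<lambda>j\<in>{1..n}. \<one>\<^bsub>G\<^esub>)"
| "tuple_letter G n (Some (i, s)) = (\<lambda>j\<in>{1..n}. if j = i then s else \<one>\<^bsub>G\<^esub>)"

fun letter_weight :: "('a \<Rightarrow> nat) \<Rightarrow> (nat \<times> 'a) option \<Rightarrow> nat" where
  "letter_weight \<omega> None = 1"
| "letter_weight \<omega> (Some (i, s)) = \<omega> s"

fun component :: "nat \<Rightarrow> (nat \<times> 'a) option list \<Rightarrow> 'a list" where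
  "component j [] = []"
| "component j (None # w) = component j w"
| "component j (Some (i, s) # w) = (if i = j then s # component j w else component j w)"

lemma component_append: "component j (v @ w) = component j v @ component j w"
  by (induction j v rule: component.induct) auto

lemma component_in_lists: "w \<in> lists (tuple_letters n S) \<Longrightarrow> component j w \<in> lists S"
  by (induction j w rule: component.induct) (auto simp: tuple_letters_def)

lemma component_weight:
  "w \<in> lists (tuple_letters n S) \<Longrightarrow>
    (\<Sum>j=1..n. word_weight \<omega> (component j w)) \<le> (\<Sum>a\<leftarrow>w. letter_weight \<omega> a)"
proof (induction w)
  case (Cons a w)
  then have IH: "(\<Sum>j=1..n. word_weight \<omega> (component j w)) \<le> (\<Sum>a\<leftarrow>w. letter_weight \<omega> a)"
    by simp
  show ?case
  proof (cases a)
    case None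
    then show ?thesis
      using IH by simp
  next
    case (Some p)
    then obtain i s where a: "a = Some (i, s)" "i \<in> {1..n}"
      using Cons.prems by (cases p) (auto simp: tuple_letters_def)
    have "(\<Sum>j=1..n. word_weight \<omega> (component j (a # w)))
        = (\<Sum>j=1..n. word_weight \<omega> (component j w) + (if i = j then \<omega> s else 0))"
      by (intro sum.cong) (auto simp: a word_weight_def)
    also have "\<dots> = (\<Sum>j=1..n. word_weight \<omega> (component j w)) + \<omega> s"
      using a(2) by (simp add: sum.distrib)
    finally show ?thesis
      using IH a by simp
  qed
qed (simp add: word_weight_def)

context group
begin

lemma word_value_component:
  assumes "S \<subseteq> carrier G" "w \<in> lists (tuple_letters n S)"
  shows "word_value (product_group {1..n} (\<lambda>_. G)) (map (tuple_letter G n) w)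
    = (\<lambda>j\<in>{1..n}. word_value G (component j w))"
  using assms(2)
proof (induction w)
  case (Cons a w)
  then have w: "w \<in> lists (tuple_letters n S)"
    by simp
  have closed: "word_value G (component j w) \<in> carrier G" for j
  proof -
    have "word_value G v \<in> carrier G" if "v \<in> lists S" for v
      using that assms(1) by (induction v) (auto simp: word_value_def)
    then show ?thesis
      using component_in_lists[OF w] by blast
  qed
  have "word_value (product_group {1..n} (\<lambda>_. G)) (map (tuple_letter G n) (a # w))
      = (\<lambda>j\<in>{1..n}. tuple_letter G n a j \<otimes> word_value G (component j w))"
    using Cons by (simp add: word_value_def fun_eq_iff)
  also have "\<dots> = (\<lambda>j\<in>{1..n}. word_value G (component j (a # w)))"
  proof (rule restrict_ext)
    fix j assume j: "j \<in> {1..n}"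
    show "tuple_letter G n a j \<otimes> word_value G (component j w) = word_value G (component j (a # w))"
    proof (cases a)
      case None
      then show ?thesis
        using closed j by simp
    next
      case (Some p)
      then show ?thesis
        using closed j by (cases p) (auto simp: word_value_def)
    qed
  qed
  finally show ?case .
qed (simp add: word_value_def)

lemma tuple_word_exists:
  assumes u: "\<And>i. i \<in> {1..n} \<Longrightarrow> u i \<in> lists S" and le: "(\<Sum>i=1..n. word_weight \<omega> (u i)) \<le> m"
  obtains w where "w \<in> lists (tuple_letters n S)" "\<And>j. j \<in> {1..n} \<Longrightarrow> component j w = u j"
    "(\<Sum>a\<leftarrow>w. letter_weight \<omega> a) = m"
proof -
  define b where "b i = map (\<lambda>s. Some (i, s)) (u i)" for i
  define c where "c js = concat (map b js)" for js
  define k where "k = m - (\<Sum>i=1..n. word_weight \<omega> (u i))"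
  define w where "w = c [1..<Suc n] @ replicate k None"
  have comp_map: "component j (map (\<lambda>s. Some (i, s)) v) = (if i = j then v else [])" for i j and v :: "'c list"
    by (induction v) auto
  have comp_c: "component j (c js) = (if j \<in> set js then u j else [])" if "distinct js" for j js
    using that by (induction js) (auto simp: c_def b_def component_append comp_map)
  have comp_rep: "component j (replicate k None) = []" for j and k
    by (induction k) auto
  have wt_b: "(\<Sum>a\<leftarrow>b i. letter_weight \<omega> a) = word_weight \<omega> (u i)" for i
    by (simp add: b_def word_weight_def comp_def)
  have wt_c: "(\<Sum>a\<leftarrow>c js. letter_weight \<omega> a) = (\<Sum>i\<leftarrow>js. word_weight \<omega> (u i))" for js
    by (induction js) (simp_all add: c_def wt_b)
  have "s \<in> S" if "1 \<le> i" "i \<le> n" "s \<in> set (u i)" for i s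
    using u[of i] that by auto
  then have "w \<in> lists (tuple_letters n S)"
    by (force simp: w_def c_def b_def tuple_letters_def)
  moreover have "component j w = u j" if "j \<in> {1..n}" for j
    using that by (simp add: w_def component_append comp_c comp_rep del: upt_Suc)
  moreover have "(\<Sum>a\<leftarrow>w. letter_weight \<omega> a) = m"
  proof -
    have "(\<Sum>i\<leftarrow>[1..<Suc n]. word_weight \<omega> (u i)) = (\<Sum>i=1..n. word_weight \<omega> (u i))"
      by (simp only: interv_sum_list_conv_sum_set_nat set_upt atLeastLessThanSuc_atLeastAtMost)
    then show ?thesis
      using le by (simp add: w_def wt_c k_def sum_list_replicate del: upt_Suc)
  qed
  ultimately show ?thesis
    using that by blast
qed

end

lemma elem_weight_le:
  "w \<in> lists S \<Longrightarrow> elem_weight G S \<omega> (word_value G w) \<le> word_weight \<omega> w"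
  unfolding elem_weight_def by (rule Least_le) blast

lemma elem_weight_attained:
  assumes "word_generates G S" "g \<in> carrier G"
  obtains w where "w \<in> lists S" "word_value G w = g" "word_weight \<omega> w = elem_weight G S \<omega> g"
proof -
  have "\<exists>k. \<exists>w\<in>lists S. word_value G w = g \<and> word_weight \<omega> w = k"
    using assms unfolding word_generates_def by blast
  from LeastI_ex[OF this, folded elem_weight_def] show ?thesis
    using that by blast
qed

text \<open>Letters in different coordinates are independent: a word over the combined alphabet amounts to one
  word per coordinate, so the least weight for a tuple is the sum of the least weights of its
  entries.\<close>

lemma (in group) tuple_weight_le_iff:
  assumes S: "word_generates G S" and x: "x \<in> {1..n} \<rightarrow>\<^sub>E carrier G"
  shows "(\<exists>w\<in>lists (tuple_letters n S).
      word_value (product_group {1..n} (\<lambda>_. G)) (map (tuple_letter G n) w) = x \<and>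
      (\<Sum>a\<leftarrow>w. letter_weight \<omega> a) = m) \<longleftrightarrow> tuple_weight G n S \<omega> x \<le> m"
    (is "?lhs \<longleftrightarrow> ?rhs")
proof
  have SG: "S \<subseteq> carrier G"
    using S by (simp add: word_generates_def)
  {
    assume ?lhs
    then obtain w where w: "w \<in> lists (tuple_letters n S)" "(\<Sum>a\<leftarrow>w. letter_weight \<omega> a) = m"
      "(\<lambda>j\<in>{1..n}. word_value G (component j w)) = x"
      using word_value_component[OF SG] by metis
    have "tuple_weight G n S \<omega> x \<le> (\<Sum>j=1..n. word_weight \<omega> (component j w))"
      unfolding tuple_weight_def
    proof (rule sum_mono)
      fix j assume "j \<in> {1..n}"
      then have "x j = word_value G (component j w)"
        using w(3) by auto
      then show "elem_weight G S \<omega> (x j) \<le> word_weight \<omega> (component j w)"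
        using component_in_lists[OF w(1)] by (simp add: elem_weight_le)
    qed
    then show ?rhs
      using component_weight[OF w(1), of \<omega>] w(2) by simp
  }
  {
    assume le: ?rhs
    have "\<exists>v. v \<in> lists S \<and> word_value G v = x i \<and> word_weight \<omega> v = elem_weight G S \<omega> (x i)"
      if "i \<in> {1..n}" for i
      using elem_weight_attained[OF S, where g = "x i" and \<omega> = \<omega>] x that by (metis PiE_mem)
    then obtain u where u: "\<And>i. i \<in> {1..n} \<Longrightarrow> u i \<in> lists S"
      "\<And>i. i \<in> {1..n} \<Longrightarrow> word_value G (u i) = x i"
      "\<And>i. i \<in> {1..n} \<Longrightarrow> word_weight \<omega> (u i) = elem_weight G S \<omega> (x i)"
      by metis
    have "(\<Sum>i=1..n. word_weight \<omega> (u i)) \<le> m"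
      using le u(3) by (simp add: tuple_weight_def)
    then obtain w where w: "w \<in> lists (tuple_letters n S)" "\<And>j. j \<in> {1..n} \<Longrightarrow> component j w = u j"
      "(\<Sum>a\<leftarrow>w. letter_weight \<omega> a) = m"
      using tuple_word_exists[where n = n and u = u and m = m and \<omega> = \<omega>, OF u(1)] by blast
    have "(\<lambda>j\<in>{1..n}. word_value G (component j w)) = x"
    proof (rule extensionalityI[of _ "{1..n}"])
      show "x \<in> extensional {1..n}"
        using x by (simp add: PiE_iff)
    qed (use w(2) u(2) in auto)
    then show ?lhs
      using w word_value_component[OF SG w(1)] by (intro bexI[of _ w]) auto
  }
qed

lemma (in group) rational_growth_algebraic_set:
  assumes H: "subgroup H G" "comm_group (G\<lparr>carrier := H\<rparr>)" "finite (rcosets H)"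
    and alg: "algebraic_set G n V"
    and S: "finite S" "word_generates G S" "\<forall>s\<in>S. \<omega> s > 0"
  shows "rational_fps (growth_series G n S \<omega> V)"
proof -
  obtain N and \<kappa> :: "'a \<Rightarrow> 'a set \<Rightarrow> 'a set"
    where N: "N \<lhd> G" and N_comm: "\<And>a b. a \<in> N \<Longrightarrow> b \<in> N \<Longrightarrow> a \<otimes> b = b \<otimes> a"
      and \<kappa>: "finite (\<kappa> ` carrier G)"
      "\<And>x y. x \<in> carrier G \<Longrightarrow> y \<in> carrier G \<Longrightarrow> \<kappa> x = \<kappa> y \<Longrightarrow> x \<otimes> inv y \<in> N"
    using finite_index_abelian_normal[OF H] by blast
  have SG: "S \<subseteq> carrier G"
    using S(2) by (simp add: word_generates_def)
  let ?P = "product_group {1..n} (\<lambda>_. G)"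
  have P: "group ?P"
    by (simp add: is_group)
  have P_inv: "inv\<^bsub>?P\<^esub> x = (\<lambda>i\<in>{1..n}. inv (x i))" if "x \<in> {1..n} \<rightarrow>\<^sub>E carrier G" for x
    using that by (intro inv_product_group) (simp_all add: is_group)
  interpret A: coset_automaton ?P "{1..n} \<rightarrow>\<^sub>E N" "\<lambda>x. \<lambda>i\<in>{1..n}. \<kappa> (x i)"
    "tuple_letters n S" "tuple_letter G n" "letter_weight \<omega>"
  proof (intro coset_automaton.intro coset_automaton_axioms.intro P)
    show "subgroup ({1..n} \<rightarrow>\<^sub>E N) ?P"
      using PiE_subgroup_product_group[of "{1..n}" "\<lambda>_. G" "\<lambda>_. N"] normal_imp_subgroup[OF N]
      by (simp add: is_group)
    show "a \<otimes>\<^bsub>?P\<^esub> b = b \<otimes>\<^bsub>?P\<^esub> a" if "a \<in> {1..n} \<rightarrow>\<^sub>E N" "b \<in> {1..n} \<rightarrow>\<^sub>E N" for a b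
      using that N_comm by (auto intro!: restrict_ext)
    have "(\<lambda>x. \<lambda>i\<in>{1..n}. \<kappa> (x i)) ` carrier ?P \<subseteq> {1..n} \<rightarrow>\<^sub>E \<kappa> ` carrier G"
      by auto
    then show "finite ((\<lambda>x. \<lambda>i\<in>{1..n}. \<kappa> (x i)) ` carrier ?P)"
      by (rule finite_subset) (intro finite_PiE finite_atLeastAtMost \<kappa>(1))
    show "x \<otimes>\<^bsub>?P\<^esub> inv\<^bsub>?P\<^esub> y \<in> {1..n} \<rightarrow>\<^sub>E N"
      if "x \<in> carrier ?P" "y \<in> carrier ?P" "(\<lambda>i\<in>{1..n}. \<kappa> (x i)) = (\<lambda>i\<in>{1..n}. \<kappa> (y i))" for x y
    proof -
      have xy: "x \<in> {1..n} \<rightarrow>\<^sub>E carrier G" "y \<in> {1..n} \<rightarrow>\<^sub>E carrier G"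
        using that(1,2) by simp_all
      have "\<kappa> (x i) = \<kappa> (y i)" if "i \<in> {1..n}" for i
        using fun_cong[OF \<open>(\<lambda>i\<in>{1..n}. \<kappa> (x i)) = (\<lambda>i\<in>{1..n}. \<kappa> (y i))\<close>, of i] that by simp
      then show ?thesis
        using xy \<kappa>(2) unfolding P_inv[OF xy(2)] mult_product_group
        by (intro restrict_PiE_iff[THEN iffD2] ballI) (auto simp: PiE_iff)
    qed
    show "finite (tuple_letters n S)"
      using S(1) by (simp add: tuple_letters_def)
    show "tuple_letter G n s \<in> carrier ?P" if "s \<in> tuple_letters n S" for s
      using that SG by (auto simp: tuple_letters_def)
    show "0 < letter_weight \<omega> s" if "s \<in> tuple_letters n S" for s
      using that S(3) by (auto simp: tuple_letters_def)
  qed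
  have V: "V \<subseteq> {1..n} \<rightarrow>\<^sub>E carrier G"
    using alg by (auto simp: algebraic_set_def solution_set_def)
  define B where "B m = {x \<in> V. tuple_weight G n S \<omega> x \<le> m}" for m
  have B: "B m = {x \<in> V. \<exists>w\<in>lists (tuple_letters n S).
      word_value ?P (map (tuple_letter G n) w) = x \<and> (\<Sum>a\<leftarrow>w. letter_weight \<omega> a) = m}" for m
    unfolding B_def
    by (rule Collect_cong, rule conj_cong[OF HOL.refl],
        rule tuple_weight_le_iff[OF S(2), symmetric], erule subsetD[OF V])
  have "rational_fps (Abs_fps (\<lambda>m. of_nat (card (B m))) :: rat fps) \<and> (\<forall>m. finite (B m))"
    unfolding B
  proof (rule A.rational_word_weights)
    fix x y z assume V_in: "x \<in> V" "y \<in> V" "z \<in> V"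
      and coset: "x \<otimes>\<^bsub>?P\<^esub> inv\<^bsub>?P\<^esub> y \<in> {1..n} \<rightarrow>\<^sub>E N" "z \<otimes>\<^bsub>?P\<^esub> inv\<^bsub>?P\<^esub> y \<in> {1..n} \<rightarrow>\<^sub>E N"
    have xyz: "x \<in> {1..n} \<rightarrow>\<^sub>E carrier G" "y \<in> {1..n} \<rightarrow>\<^sub>E carrier G" "z \<in> {1..n} \<rightarrow>\<^sub>E carrier G"
      using V_in V by auto
    let ?u = "\<lambda>i\<in>{1..n}. x i \<otimes> inv (y i) \<otimes> z i"
    have u: "x \<otimes>\<^bsub>?P\<^esub> inv\<^bsub>?P\<^esub> y \<otimes>\<^bsub>?P\<^esub> z = ?u"
      unfolding P_inv[OF xyz(2)] mult_product_group by (rule restrict_ext) simp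
    have uG: "?u \<in> {1..n} \<rightarrow>\<^sub>E carrier G"
      using xyz by (auto simp: PiE_iff)
    have "heap N (x i) (y i) (z i) (?u i)" if i: "i \<in> {1..n}" for i
    proof -
      have "x i \<otimes> inv (y i) \<in> N" "z i \<otimes> inv (y i) \<in> N"
        using PiE_mem[OF coset(1) i] PiE_mem[OF coset(2) i] i
        unfolding P_inv[OF xyz(2)] mult_product_group by simp_all
      then show ?thesis
        using PiE_mem[OF xyz(1) i] PiE_mem[OF xyz(2) i] PiE_mem[OF xyz(3) i] i by (simp add: heap_def)
    qed
    then show "x \<otimes>\<^bsub>?P\<^esub> inv\<^bsub>?P\<^esub> y \<otimes>\<^bsub>?P\<^esub> z \<in> V"
      unfolding u using algebraic_set_heap[OF N N_comm alg V_in uG] by blast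
  qed
  then have rat: "rational_fps (Abs_fps (\<lambda>m. of_nat (card (B m))) :: rat fps)"
    and fin: "\<And>m. finite (B m)"
    by auto
  \<comment> \<open>Passing from weight at most \<open>m\<close> to weight exactly \<open>m\<close> multiplies the series by \<open>1 - z\<close>.\<close>
  let ?B = "Abs_fps (\<lambda>m. of_nat (card (B m))) :: rat fps"
  have "growth_series G n S \<omega> V = ?B * fps_of_poly (1 - monom 1 1)"
  proof (rule fps_ext)
    fix m
    let ?s = "{x \<in> V. tuple_weight G n S \<omega> x = m}"
    have "of_nat (card ?s) = fps_nth (?B - ?B * fps_X) m"
    proof (cases m)
      case 0
      then have "B m = ?s"
        by (auto simp: B_def)
      then show ?thesis
        using 0 by simp
    next
      case (Suc k)
      have "B m = B k \<union> ?s" "B k \<inter> ?s = {}"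
        using Suc by (auto simp: B_def)
      moreover have "finite ?s"
        using fin[of m] by (rule finite_subset[rotated]) (auto simp: B_def)
      ultimately have "card (B m) = card (B k) + card ?s"
        using fin[of k] by (simp add: card_Un_disjoint)
      then show ?thesis
        using Suc by simp
    qed
    then show "fps_nth (growth_series G n S \<omega> V) m = fps_nth (?B * fps_of_poly (1 - monom 1 1)) m"
      by (simp add: growth_series_def growth_fun_def fps_of_poly_diff fps_of_poly_monom algebra_simps)
  qed
  then show ?thesis
    using rational_fps_mult_poly[OF rat] by simp
qed

theorem theorem4p3:
  fixes G :: "('a, 'b) monoid_scheme" and n :: nat and V :: "(nat \<Rightarrow> 'a) set"
    and S :: "'a set" and \<omega> :: "'a \<Rightarrow> nat"
  assumes "finitely_generated_group G" and "virtually_abelian_group G"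
    and "n \<ge> 1"
    and "algebraic_set G n V"
    and "finite S" and "word_generates G S"
    and "\<forall>s\<in>S. \<omega> s > 0"
  shows "rational_fps (growth_series G n S \<omega> V)"
proof -
  obtain H where "group G"
    and H: "subgroup H G" "comm_group (G\<lparr>carrier := H\<rparr>)" "finite (rcosets\<^bsub>G\<^esub> H)"
    using assms(2) unfolding virtually_abelian_group_def by blast
  from group.rational_growth_algebraic_set[OF \<open>group G\<close> H assms(4-7)] show ?thesis .
qed

end
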